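(* Let $(Q,Y,X,M)$ be a bundle 2-gerbe on $M$. To each point $m$ of $M$ one can associate a bicategory $\mathcal{Q}_m$ defined as follows. The objects of $\mathcal{Q}_m$ are the points of $X_m=\pi^{-1}(m)$. For objects $x_i,x_j$ the category $\mathrm{Hom}(x_i,x_j)$ has as objects (1-arrows) the points of the fibre $Y_{(x_i,x_j)}$ and as arrows (2-arrows) $y\Rightarrow y'$ the points of $Q_{(y,y')}$, with composition given by the bundle gerbe product of $Q$. The composition functor $\mathrm{Hom}(x_j,x_k)\times\mathrm{Hom}(x_i,x_j)\to\mathrm{Hom}(x_i,x_k)$ is given by $m$ on 1-arrows and $\hat m$ on 2-arrows. The associativity isomorphism at $(y_{kl},y_{jk},y_{ij})$ is $\hat a(y_{kl},y_{jk},y_{ij})$. The identity 1-arrow at $x$ is a chosen point of $Y_{(x,x)}$ (chosen by an arbitrary set-theoretic section of $Y$ over the diagonal), with suitable left and right identity isomorphisms.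
   Context: For a smooth surjection $\pi:X\to M$ admitting local sections, $X^{[p]}$ is the $p$-fold fibre product over $M$ and $\pi_i:X^{[p]}\to X^{[p-1]}$ omits the $i$-th factor. A bundle gerbe $(P,Z,N)$ consists of a surjection $Z\to N$ admitting local sections and a principal $\mathbb{C}^\times$ bundle $P\to Z^{[2]}$ with an associative product $m_P:P_{(z_2,z_3)}\otimes P_{(z_1,z_2)}\to P_{(z_1,z_3)}$ (a $\mathbb{C}^\times$ bundle isomorphism over $Z^{[3]}$); it has an identity section $e(z)\in P_{(z,z)}$ and inverses $P_{(z_1,z_2)}\to P_{(z_2,z_1)}$. A bundle gerbe morphism $\bar f=(\hat f,f,\mathrm{id})$ over $N$ is a map $f$ over $N$ together with a $\mathbb{C}^\times$ bundle map $\hat f$ covering $f^{[2]}$ and commuting with products. A transformation $\bar f\Rightarrow\bar g$ between bundle gerbe morphisms from $(P,Z,N)$ to $(P',Z',N)$ is a smooth section $\hat\theta$, $\hat\theta(z)\in P'_{(f(z),g(z))}$, such that $\hat\theta(z_2)\hat f(p)=\hat g(p)\hat\theta(z_1)$ for all $p\in P_{(z_1,z_2)}$. A bundle 2-gerbe $(Q,Y,X,M)$ consists of: a smooth surjection $\pi:X\to M$ admitting local sections; a bundle gerbe $(Q,Y,X^{[2]})$; a bundle gerbe morphism $\bar m=(\hat m,m,\mathrm{id}):\pi_1^{-1}Q\otimes\pi_3^{-1}Q\to\pi_2^{-1}Q$ over $X^{[3]}$, given fibrewise by $m:Y_{(x_2,x_3)}\times Y_{(x_1,x_2)}\to Y_{(x_1,x_3)}$,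 $(y_{23},y_{12})\mapsto y_{23}\circ y_{12}$, and $\hat m:Q_{(y_{23},y_{23}')}\otimes Q_{(y_{12},y_{12}')}\to Q_{(y_{23}\circ y_{12},\,y_{23}'\circ y_{12}')}$; and a transformation $a:\bar m_1\Rightarrow\bar m_2$ over $X^{[4]}$ between the two induced morphisms ($m_1(y_{34},y_{23},y_{12})=(y_{34}\circ y_{23})\circ y_{12}$, $m_2(y_{34},y_{23},y_{12})=y_{34}\circ(y_{23}\circ y_{12})$), given by $\hat a(y_{34},y_{23},y_{12})\in Q_{((y_{34}\circ y_{23})\circ y_{12},\,y_{34}\circ(y_{23}\circ y_{12}))}$, satisfying the coherency condition over $X^{[5]}$ (products in $Q$, composed right to left) $$\hat a(y_{45}\circ y_{34},y_{23},y_{12})^{-1}\,\hat a(y_{45},y_{34},y_{23}\circ y_{12})^{-1}\,\hat m(e(y_{45})\otimes\hat a(y_{34},y_{23},y_{12}))\,\hat a(y_{45},y_{34}\circ y_{23},y_{12})\,\hat m(\hat a(y_{45},y_{34},y_{23})\otimes e(y_{12}))=e(((y_{45}\circ y_{34})\circ y_{23})\circ y_{12}).$$ *)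

theory Defs
  imports "HOL-Analysis.Analysis"
begin

section \<open>Smooth maps between open subsets of Banach spaces\<close>

text \<open>
  Only used for an open set \<open>S\<close>. On Banach spaces asking for continuity of
  the iterated derivatives one direction at a time gives the usual notion of a smooth map, by
  the uniform boundedness principle; in finite dimensions this is the familiar description by
  partial derivatives.
\<close>

primrec Ck_on :: "nat \<Rightarrow> 'a::real_normed_vector set \<Rightarrow> ('a \<Rightarrow> 'b::real_normed_vector) \<Rightarrow> bool" where
  "Ck_on 0 S f \<longleftrightarrow> continuous_on S f"
| "Ck_on (Suc k) S f \<longleftrightarrow>
     (\<forall>x\<in>S. f differentiable (at x)) \<and> (\<forall>v. Ck_on k S (\<lambda>x. frechet_derivative f (at x) v))"

definition smooth_on :: "'a::real_normed_vector set \<Rightarrow> ('a \<Rightarrow> 'b::real_normed_vector) \<Rightarrow> bool" where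
  "smooth_on S f \<longleftrightarrow> (\<forall>k. Ck_on k S f)"


section \<open>Manifolds and subsets of manifolds\<close>

text \<open>
  A smooth space is a set \<open>pts\<close> of points of an ambient manifold; it is a manifold if
  \<open>pts\<close> is everything. A map between smooth spaces is smooth if near each point it
  is the restriction of a smooth map between the ambient manifolds. This is how a fibre product
  carries its smooth structure, as a subset of the product manifold. For fibre products of
  submersions, which are embedded submanifolds, it is the usual structure.

  Manifolds are modelled on an arbitrary Banach space \<open>'e\<close>. Finite-dimensional
  manifolds are the case of a finite-dimensional \<open>'e\<close> (the class allows the trivial
  space, so dimension 0 is included).
\<close>

record ('a, 'e) smooth_space =
  amb :: "'a topology"
  atlas :: "('a set \<times> ('a \<Rightarrow> 'e)) set"
  pts :: "'a set"

definition smooth_manifold :: "('a, 'e::banach) smooth_space \<Rightarrow> bool" where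
  "smooth_manifold A \<longleftrightarrow>
     pts A = topspace (amb A) \<and> Hausdorff_space (amb A) \<and> second_countable (amb A) \<and>
     (\<Union>(U, \<phi>)\<in>atlas A. U) = topspace (amb A) \<and>
     (\<forall>(U, \<phi>)\<in>atlas A. openin (amb A) U \<and> open (\<phi> ` U) \<and>
        homeomorphic_map (subtopology (amb A) U) (top_of_set (\<phi> ` U)) \<phi>) \<and>
     (\<forall>(U, \<phi>)\<in>atlas A. \<forall>(V, \<psi>)\<in>atlas A. smooth_on (\<phi> ` (U \<inter> V)) (\<psi> \<circ> inv_into U \<phi>))"

definition smooth_on_open ::
  "('a, 'e::banach) smooth_space \<Rightarrow> ('b, 'f::banach) smooth_space \<Rightarrow> 'a set \<Rightarrow> ('a \<Rightarrow> 'b) \<Rightarrow> bool" where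
  "smooth_on_open A B U F \<longleftrightarrow>
     openin (amb A) U \<and> continuous_map (subtopology (amb A) U) (amb B) F \<and>
     (\<forall>(V, \<phi>)\<in>atlas A. \<forall>(W, \<psi>)\<in>atlas B.
        smooth_on (\<phi> ` (U \<inter> V \<inter> F -` W)) (\<psi> \<circ> F \<circ> inv_into V \<phi>))"

definition smooth_map ::
  "('a, 'e::banach) smooth_space \<Rightarrow> ('b, 'f::banach) smooth_space \<Rightarrow> ('a \<Rightarrow> 'b) \<Rightarrow> bool" where
  "smooth_map A B f \<longleftrightarrow>
     f ` pts A \<subseteq> pts B \<and>
     (\<forall>p\<in>pts A. \<exists>U F. p \<in> U \<and> smooth_on_open A B U F \<and> (\<forall>x\<in>pts A \<inter> U. f x = F x))"

definition subspace_of :: "('a, 'e) smooth_space \<Rightarrow> 'a set \<Rightarrow> ('a, 'e) smooth_space" where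
  "subspace_of A S = A\<lparr>pts := pts A \<inter> S\<rparr>"

definition prod_space ::
  "('a, 'e) smooth_space \<Rightarrow> ('b, 'f) smooth_space \<Rightarrow> ('a \<times> 'b, 'e \<times> 'f) smooth_space" where
  "prod_space A B =
     \<lparr>amb = prod_topology (amb A) (amb B),
      atlas = {(U \<times> V, map_prod \<phi> \<psi>) |U \<phi> V \<psi>. (U, \<phi>) \<in> atlas A \<and> (V, \<psi>) \<in> atlas B},
      pts = pts A \<times> pts B\<rparr>"

definition Cstar :: "(complex, complex) smooth_space" where
  "Cstar = \<lparr>amb = top_of_set (- {0}), atlas = {(- {0}, \<lambda>z. z)}, pts = - {0}\<rparr>"

definition fibre_square ::
  "('a, 'e) smooth_space \<Rightarrow> ('a \<Rightarrow> 'b) \<Rightarrow> ('a \<times> 'a, 'e \<times> 'e) smooth_space" where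
  "fibre_square A \<pi> = subspace_of (prod_space A A) {(a, a'). \<pi> a = \<pi> a'}"

text \<open>Smooth surjection admitting local sections; surjectivity is implied by the latter.\<close>

definition locally_split ::
  "('a, 'e::banach) smooth_space \<Rightarrow> ('b, 'f::banach) smooth_space \<Rightarrow> ('a \<Rightarrow> 'b) \<Rightarrow> bool" where
  "locally_split A B \<pi> \<longleftrightarrow>
     smooth_map A B \<pi> \<and> \<pi> ` pts A = pts B \<and>
     (\<forall>b\<in>pts B. \<exists>V s. openin (amb B) V \<and> b \<in> V \<and>
        smooth_map (subspace_of B V) A s \<and> (\<forall>b'\<in>pts B \<inter> V. \<pi> (s b') = b'))"


section \<open>Principal bundles and bundle gerbes\<close>

definition principal_Cstar_bundle ::
  "('p, 'e::banach) smooth_space \<Rightarrow> ('b, 'f::banach) smooth_space \<Rightarrow> ('p \<Rightarrow> 'b) \<Rightarrow>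
   (complex \<Rightarrow> 'p \<Rightarrow> 'p) \<Rightarrow> bool" where
  "principal_Cstar_bundle P B pr ac \<longleftrightarrow>
     smooth_manifold P \<and> smooth_map P B pr \<and>
     smooth_map (prod_space Cstar P) P (\<lambda>(c, p). ac c p) \<and>
     (\<forall>p\<in>pts P. ac 1 p = p) \<and>
     (\<forall>c d. \<forall>p\<in>pts P. c \<noteq> 0 \<longrightarrow> d \<noteq> 0 \<longrightarrow> ac (c * d) p = ac c (ac d p)) \<and>
     (\<forall>c. \<forall>p\<in>pts P. c \<noteq> 0 \<longrightarrow> pr (ac c p) = pr p) \<and>
     (\<forall>b\<in>pts B. \<exists>V \<phi> \<psi>. openin (amb B) V \<and> b \<in> V \<and>
        smooth_map (prod_space (subspace_of B V) Cstar) (subspace_of P (pr -` V)) \<phi> \<and>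
        smooth_map (subspace_of P (pr -` V)) (prod_space (subspace_of B V) Cstar) \<psi> \<and>
        (\<forall>u\<in>pts (prod_space (subspace_of B V) Cstar). \<psi> (\<phi> u) = u \<and> pr (\<phi> u) = fst u) \<and>
        (\<forall>p\<in>pts (subspace_of P (pr -` V)). \<phi> (\<psi> p) = p) \<and>
        (\<forall>b'\<in>pts (subspace_of B V). \<forall>c d. c \<noteq> 0 \<longrightarrow> d \<noteq> 0 \<longrightarrow>
           \<phi> (b', c * d) = ac c (\<phi> (b', d))))"

record ('p, 'ep, 'z, 'ez, 'n, 'en) bundle_gerbe_data =
  total_space :: "('p, 'ep) smooth_space"
  cover :: "('z, 'ez) smooth_space"
  gbase :: "('n, 'en) smooth_space"
  cover_proj :: "'z \<Rightarrow> 'n"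
  bundle_proj :: "'p \<Rightarrow> 'z \<times> 'z"
  cact :: "complex \<Rightarrow> 'p \<Rightarrow> 'p"
  gmult :: "'p \<Rightarrow> 'p \<Rightarrow> 'p"

definition gfibre :: "('p, 'ep, 'z, 'ez, 'n, 'en) bundle_gerbe_data \<Rightarrow> 'z \<Rightarrow> 'z \<Rightarrow> 'p set" where
  "gfibre G z z' = {p \<in> pts (total_space G). bundle_proj G p = (z, z')}"

text \<open>
  A map of \<open>\<complex>\<^sup>\<times>\<close> bundles out of a tensor product is
  given as a smooth fibre-preserving map on the fibre product of the two bundles which is
  equivariant in each argument separately, that is, which descends to the tensor product;
  over the identity, such a map is automatically an isomorphism of principal bundles.
  The product takes \<open>p23 \<in> P(z2, z3)\<close> and
  \<open>p12 \<in> P(z1, z2)\<close>, in this order, to \<open>P(z1, z3)\<close>.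
\<close>

definition bundle_gerbe ::
  "('p, 'ep::banach, 'z, 'ez::banach, 'n, 'en::banach) bundle_gerbe_data \<Rightarrow> bool" where
  "bundle_gerbe G \<longleftrightarrow>
     smooth_manifold (cover G) \<and>
     locally_split (cover G) (gbase G) (cover_proj G) \<and>
     principal_Cstar_bundle (total_space G) (fibre_square (cover G) (cover_proj G))
       (bundle_proj G) (cact G) \<and>
     smooth_map
       (subspace_of (prod_space (total_space G) (total_space G))
          {(p, p'). fst (bundle_proj G p) = snd (bundle_proj G p')})
       (total_space G) (\<lambda>(p, p'). gmult G p p') \<and>
     (\<forall>z1 z2 z3. \<forall>p23\<in>gfibre G z2 z3. \<forall>p12\<in>gfibre G z1 z2.
        gmult G p23 p12 \<in> gfibre G z1 z3 \<and>
        (\<forall>c. c \<noteq> 0 \<longrightarrow>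
           gmult G (cact G c p23) p12 = cact G c (gmult G p23 p12) \<and>
           gmult G p23 (cact G c p12) = cact G c (gmult G p23 p12))) \<and>
     (\<forall>z1 z2 z3 z4. \<forall>p34\<in>gfibre G z3 z4. \<forall>p23\<in>gfibre G z2 z3. \<forall>p12\<in>gfibre G z1 z2.
        gmult G p34 (gmult G p23 p12) = gmult G (gmult G p34 p23) p12)"

text \<open>The identity section and the inverses that a bundle gerbe has by its other axioms.\<close>

definition gid :: "('p, 'ep, 'z, 'ez, 'n, 'en) bundle_gerbe_data \<Rightarrow> 'z \<Rightarrow> 'p" where
  "gid G z = (THE e. e \<in> gfibre G z z \<and>
     (\<forall>z'. (\<forall>p\<in>gfibre G z' z. gmult G e p = p) \<and> (\<forall>p\<in>gfibre G z z'. gmult G p e = p)))"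

definition ginv :: "('p, 'ep, 'z, 'ez, 'n, 'en) bundle_gerbe_data \<Rightarrow> 'p \<Rightarrow> 'p" where
  "ginv G p = (THE p'. p' \<in> gfibre G (snd (bundle_proj G p)) (fst (bundle_proj G p)) \<and>
     gmult G p' p = gid G (fst (bundle_proj G p)) \<and> gmult G p p' = gid G (snd (bundle_proj G p)))"


section \<open>Bundle 2-gerbes\<close>

record ('q, 'eq, 'y, 'ey, 'x, 'ex, 'm, 'em) bundle_2_gerbe_data =
  base :: "('m, 'em) smooth_space"
  space :: "('x, 'ex) smooth_space"
  proj :: "'x \<Rightarrow> 'm"
  gerbe :: "('q, 'eq, 'y, 'ey, 'x \<times> 'x, 'ex \<times> 'ex) bundle_gerbe_data"
  mcomp :: "'y \<Rightarrow> 'y \<Rightarrow> 'y"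
  mhat :: "'q \<Rightarrow> 'q \<Rightarrow> 'q"
  ahat :: "'y \<Rightarrow> 'y \<Rightarrow> 'y \<Rightarrow> 'q"

definition yfibre :: "('q, 'eq, 'y, 'ey, 'x, 'ex, 'm, 'em) bundle_2_gerbe_data \<Rightarrow> 'x \<Rightarrow> 'x \<Rightarrow> 'y set" where
  "yfibre D x x' = {y \<in> pts (cover (gerbe D)). cover_proj (gerbe D) y = (x, x')}"

abbreviation qfibre :: "('q, 'eq, 'y, 'ey, 'x, 'ex, 'm, 'em) bundle_2_gerbe_data \<Rightarrow> 'y \<Rightarrow> 'y \<Rightarrow> 'q set" where
  "qfibre D \<equiv> gfibre (gerbe D)"

abbreviation qmult :: "('q, 'eq, 'y, 'ey, 'x, 'ex, 'm, 'em) bundle_2_gerbe_data \<Rightarrow> 'q \<Rightarrow> 'q \<Rightarrow> 'q" where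
  "qmult D \<equiv> gmult (gerbe D)"

text \<open>
  \<open>\<pi>\<^sub>1\<^sup>-\<^sup>1Y \<times> \<pi>\<^sub>3\<^sup>-\<^sup>1Y\<close>
  over \<open>X\<^sup>[\<^sup>3\<^sup>]\<close> and its analogue for three factors over
  \<open>X\<^sup>[\<^sup>4\<^sup>]\<close>, and the pairs of elements of \<open>Q\<close>
  lying over the former. The points of \<open>X\<close> are determined by those of
  \<open>Y\<close> above them and are not recorded.
\<close>

definition composable_pairs ::
  "('q, 'eq, 'y, 'ey, 'x, 'ex, 'm, 'em) bundle_2_gerbe_data \<Rightarrow> ('y \<times> 'y, 'ey \<times> 'ey) smooth_space" where
  "composable_pairs D = (let Y = cover (gerbe D); \<pi> = cover_proj (gerbe D) in
     subspace_of (prod_space Y Y) {(y23, y12). fst (\<pi> y23) = snd (\<pi> y12)})"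

definition composable_triples ::
  "('q, 'eq, 'y, 'ey, 'x, 'ex, 'm, 'em) bundle_2_gerbe_data \<Rightarrow>
   ('y \<times> 'y \<times> 'y, 'ey \<times> 'ey \<times> 'ey) smooth_space" where
  "composable_triples D = (let Y = cover (gerbe D); \<pi> = cover_proj (gerbe D) in
     subspace_of (prod_space Y (prod_space Y Y))
       {(y34, y23, y12). fst (\<pi> y34) = snd (\<pi> y23) \<and> fst (\<pi> y23) = snd (\<pi> y12)})"

definition composable_Q_pairs ::
  "('q, 'eq, 'y, 'ey, 'x, 'ex, 'm, 'em) bundle_2_gerbe_data \<Rightarrow> ('q \<times> 'q, 'eq \<times> 'eq) smooth_space" where
  "composable_Q_pairs D =
     (let Q = total_space (gerbe D); pr = bundle_proj (gerbe D); \<pi> = cover_proj (gerbe D) in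
      subspace_of (prod_space Q Q) {(q23, q12). fst (\<pi> (fst (pr q23))) = snd (\<pi> (fst (pr q12)))})"

text \<open>
  \<open>(mhat, mcomp)\<close> is a bundle gerbe morphism
  \<open>\<pi>\<^sub>1\<^sup>-\<^sup>1Q \<otimes> \<pi>\<^sub>3\<^sup>-\<^sup>1Q \<rightarrow> \<pi>\<^sub>2\<^sup>-\<^sup>1Q\<close>
  over \<open>X\<^sup>[\<^sup>3\<^sup>]\<close>.
\<close>

definition composition_morphism ::
  "('q, 'eq::banach, 'y, 'ey::banach, 'x, 'ex::banach, 'm, 'em::banach) bundle_2_gerbe_data \<Rightarrow> bool" where
  "composition_morphism D \<longleftrightarrow>
     smooth_map (composable_pairs D) (cover (gerbe D)) (\<lambda>(y23, y12). mcomp D y23 y12) \<and>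
     (\<forall>x1 x2 x3. \<forall>y23\<in>yfibre D x2 x3. \<forall>y12\<in>yfibre D x1 x2. mcomp D y23 y12 \<in> yfibre D x1 x3) \<and>
     smooth_map (composable_Q_pairs D) (total_space (gerbe D)) (\<lambda>(q23, q12). mhat D q23 q12) \<and>
     (\<forall>x1 x2 x3. \<forall>y23\<in>yfibre D x2 x3. \<forall>y23'\<in>yfibre D x2 x3.
        \<forall>y12\<in>yfibre D x1 x2. \<forall>y12'\<in>yfibre D x1 x2.
        \<forall>q23\<in>qfibre D y23 y23'. \<forall>q12\<in>qfibre D y12 y12'.
          mhat D q23 q12 \<in> qfibre D (mcomp D y23 y12) (mcomp D y23' y12') \<and>
          (\<forall>c. c \<noteq> 0 \<longrightarrow>
             mhat D (cact (gerbe D) c q23) q12 = cact (gerbe D) c (mhat D q23 q12) \<and>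
             mhat D q23 (cact (gerbe D) c q12) = cact (gerbe D) c (mhat D q23 q12))) \<and>
     (\<forall>x1 x2 x3. \<forall>y23\<in>yfibre D x2 x3. \<forall>y23'\<in>yfibre D x2 x3. \<forall>y23''\<in>yfibre D x2 x3.
        \<forall>y12\<in>yfibre D x1 x2. \<forall>y12'\<in>yfibre D x1 x2. \<forall>y12''\<in>yfibre D x1 x2.
        \<forall>q23\<in>qfibre D y23 y23'. \<forall>q23'\<in>qfibre D y23' y23''.
        \<forall>q12\<in>qfibre D y12 y12'. \<forall>q12'\<in>qfibre D y12' y12''.
          mhat D (qmult D q23' q23) (qmult D q12' q12) = qmult D (mhat D q23' q12') (mhat D q23 q12))"

text \<open>
  \<open>ahat\<close> is a transformation over \<open>X\<^sup>[\<^sup>4\<^sup>]\<close>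
  between the two morphisms \<open>m\<^sub>1\<close> and \<open>m\<^sub>2\<close> induced by
  \<open>(mhat, mcomp)\<close>.
\<close>

definition associator_transformation ::
  "('q, 'eq::banach, 'y, 'ey::banach, 'x, 'ex::banach, 'm, 'em::banach) bundle_2_gerbe_data \<Rightarrow> bool" where
  "associator_transformation D \<longleftrightarrow>
     smooth_map (composable_triples D) (total_space (gerbe D))
       (\<lambda>(y34, y23, y12). ahat D y34 y23 y12) \<and>
     (\<forall>x1 x2 x3 x4. \<forall>y34\<in>yfibre D x3 x4. \<forall>y23\<in>yfibre D x2 x3. \<forall>y12\<in>yfibre D x1 x2.
        ahat D y34 y23 y12
          \<in> qfibre D (mcomp D (mcomp D y34 y23) y12) (mcomp D y34 (mcomp D y23 y12))) \<and>
     (\<forall>x1 x2 x3 x4. \<forall>y34\<in>yfibre D x3 x4. \<forall>y34'\<in>yfibre D x3 x4.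
        \<forall>y23\<in>yfibre D x2 x3. \<forall>y23'\<in>yfibre D x2 x3. \<forall>y12\<in>yfibre D x1 x2. \<forall>y12'\<in>yfibre D x1 x2.
        \<forall>q34\<in>qfibre D y34 y34'. \<forall>q23\<in>qfibre D y23 y23'. \<forall>q12\<in>qfibre D y12 y12'.
          qmult D (ahat D y34' y23' y12') (mhat D (mhat D q34 q23) q12) =
          qmult D (mhat D q34 (mhat D q23 q12)) (ahat D y34 y23 y12))"

definition associator_coherent ::
  "('q, 'eq, 'y, 'ey, 'x, 'ex, 'm, 'em) bundle_2_gerbe_data \<Rightarrow> bool" where
  "associator_coherent D \<longleftrightarrow>
     (let m = mcomp D; h = mhat D; a = ahat D; e = gid (gerbe D); i = ginv (gerbe D) in
      \<forall>x1 x2 x3 x4 x5. \<forall>y45\<in>yfibre D x4 x5. \<forall>y34\<in>yfibre D x3 x4.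
      \<forall>y23\<in>yfibre D x2 x3. \<forall>y12\<in>yfibre D x1 x2.
        qmult D (i (a (m y45 y34) y23 y12))
         (qmult D (i (a y45 y34 (m y23 y12)))
          (qmult D (h (e y45) (a y34 y23 y12))
           (qmult D (a y45 (m y34 y23) y12)
            (h (a y45 y34 y23) (e y12)))))
        = e (m (m (m y45 y34) y23) y12))"

definition bundle_2_gerbe ::
  "('q, 'eq::banach, 'y, 'ey::banach, 'x, 'ex::banach, 'm, 'em::banach) bundle_2_gerbe_data \<Rightarrow> bool" where
  "bundle_2_gerbe D \<longleftrightarrow>
     smooth_manifold (base D) \<and> smooth_manifold (space D) \<and>
     locally_split (space D) (base D) (proj D) \<and>
     bundle_gerbe (gerbe D) \<and> gbase (gerbe D) = fibre_square (space D) (proj D) \<and>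
     composition_morphism D \<and> associator_transformation D \<and> associator_coherent D"


section \<open>Bicategories\<close>

text \<open>As usual, an arrow of a category determines its source and target.\<close>

record ('o, 'a) cat_data =
  Ob :: "'o set"
  Arr :: "'o \<Rightarrow> 'o \<Rightarrow> 'a set"
  Idt :: "'o \<Rightarrow> 'a"
  Comp :: "'a \<Rightarrow> 'a \<Rightarrow> 'a"

definition category :: "('o, 'a) cat_data \<Rightarrow> bool" where
  "category C \<longleftrightarrow>
     (\<forall>a\<in>Ob C. \<forall>b\<in>Ob C. \<forall>a'\<in>Ob C. \<forall>b'\<in>Ob C.
        Arr C a b \<inter> Arr C a' b' \<noteq> {} \<longrightarrow> a = a' \<and> b = b') \<and>
     (\<forall>a\<in>Ob C. Idt C a \<in> Arr C a a) \<and>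
     (\<forall>a\<in>Ob C. \<forall>b\<in>Ob C. \<forall>c\<in>Ob C. \<forall>g\<in>Arr C b c. \<forall>f\<in>Arr C a b. Comp C g f \<in> Arr C a c) \<and>
     (\<forall>a\<in>Ob C. \<forall>b\<in>Ob C. \<forall>f\<in>Arr C a b. Comp C f (Idt C a) = f \<and> Comp C (Idt C b) f = f) \<and>
     (\<forall>a\<in>Ob C. \<forall>b\<in>Ob C. \<forall>c\<in>Ob C. \<forall>d\<in>Ob C. \<forall>h\<in>Arr C c d. \<forall>g\<in>Arr C b c. \<forall>f\<in>Arr C a b.
        Comp C h (Comp C g f) = Comp C (Comp C h g) f)"

definition prod_cat :: "('o, 'a) cat_data \<Rightarrow> ('p, 'b) cat_data \<Rightarrow> ('o \<times> 'p, 'a \<times> 'b) cat_data" where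
  "prod_cat C D =
     \<lparr>Ob = Ob C \<times> Ob D,
      Arr = (\<lambda>(c, d) (c', d'). Arr C c c' \<times> Arr D d d'),
      Idt = (\<lambda>(c, d). (Idt C c, Idt D d)),
      Comp = (\<lambda>(g, g') (f, f'). (Comp C g f, Comp D g' f'))\<rparr>"

definition is_functor ::
  "('o, 'a) cat_data \<Rightarrow> ('p, 'b) cat_data \<Rightarrow> ('o \<Rightarrow> 'p) \<Rightarrow> ('a \<Rightarrow> 'b) \<Rightarrow> bool" where
  "is_functor C D F0 F1 \<longleftrightarrow>
     (\<forall>a\<in>Ob C. F0 a \<in> Ob D) \<and>
     (\<forall>a\<in>Ob C. \<forall>b\<in>Ob C. \<forall>f\<in>Arr C a b. F1 f \<in> Arr D (F0 a) (F0 b)) \<and>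
     (\<forall>a\<in>Ob C. F1 (Idt C a) = Idt D (F0 a)) \<and>
     (\<forall>a\<in>Ob C. \<forall>b\<in>Ob C. \<forall>c\<in>Ob C. \<forall>g\<in>Arr C b c. \<forall>f\<in>Arr C a b.
        F1 (Comp C g f) = Comp D (F1 g) (F1 f))"

definition is_nat_iso ::
  "('o, 'a) cat_data \<Rightarrow> ('p, 'b) cat_data \<Rightarrow> ('o \<Rightarrow> 'p) \<Rightarrow> ('a \<Rightarrow> 'b) \<Rightarrow> ('o \<Rightarrow> 'p) \<Rightarrow> ('a \<Rightarrow> 'b) \<Rightarrow>
   ('o \<Rightarrow> 'b) \<Rightarrow> bool" where
  "is_nat_iso C D F0 F1 G0 G1 \<theta> \<longleftrightarrow>
     (\<forall>a\<in>Ob C. \<theta> a \<in> Arr D (F0 a) (G0 a) \<and>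
        (\<exists>\<theta>'\<in>Arr D (G0 a) (F0 a).
           Comp D \<theta>' (\<theta> a) = Idt D (F0 a) \<and> Comp D (\<theta> a) \<theta>' = Idt D (G0 a))) \<and>
     (\<forall>a\<in>Ob C. \<forall>b\<in>Ob C. \<forall>f\<in>Arr C a b. Comp D (\<theta> b) (F1 f) = Comp D (G1 f) (\<theta> a))"

text \<open>
  \<open>hcomp1 B x y z\<close> and \<open>hcomp2 B x y z\<close> are the object and arrow parts
  of the composition functor \<open>Hom(y, z) \<times> Hom(x, y) \<rightarrow> Hom(x, z)\<close>;
  \<open>assoc B w x y z h g f : (h g) f \<Rightarrow> h (g f)\<close> for
  \<open>f : w \<rightarrow> x\<close>, \<open>g : x \<rightarrow> y\<close>, \<open>h : y \<rightarrow> z\<close>.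
\<close>

record ('o, 'b, 'c) bicat_data =
  Obj :: "'o set"
  HomCat :: "'o \<Rightarrow> 'o \<Rightarrow> ('b, 'c) cat_data"
  hcomp1 :: "'o \<Rightarrow> 'o \<Rightarrow> 'o \<Rightarrow> 'b \<Rightarrow> 'b \<Rightarrow> 'b"
  hcomp2 :: "'o \<Rightarrow> 'o \<Rightarrow> 'o \<Rightarrow> 'c \<Rightarrow> 'c \<Rightarrow> 'c"
  unit1 :: "'o \<Rightarrow> 'b"
  assoc :: "'o \<Rightarrow> 'o \<Rightarrow> 'o \<Rightarrow> 'o \<Rightarrow> 'b \<Rightarrow> 'b \<Rightarrow> 'b \<Rightarrow> 'c"
  lunit :: "'o \<Rightarrow> 'o \<Rightarrow> 'b \<Rightarrow> 'c"
  runit :: "'o \<Rightarrow> 'o \<Rightarrow> 'b \<Rightarrow> 'c"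

definition bicategory :: "('o, 'b, 'c) bicat_data \<Rightarrow> bool" where
  "bicategory B \<longleftrightarrow>
     (let H = HomCat B; c1 = hcomp1 B; c2 = hcomp2 B; a = assoc B; I = unit1 B in
      (\<forall>x\<in>Obj B. \<forall>y\<in>Obj B. category (H x y)) \<and>
      (\<forall>x\<in>Obj B. I x \<in> Ob (H x x)) \<and>
      (\<forall>x\<in>Obj B. \<forall>y\<in>Obj B. \<forall>z\<in>Obj B.
         is_functor (prod_cat (H y z) (H x y)) (H x z)
           (\<lambda>(g, f). c1 x y z g f) (\<lambda>(\<beta>, \<alpha>). c2 x y z \<beta> \<alpha>)) \<and>
      (\<forall>w\<in>Obj B. \<forall>x\<in>Obj B. \<forall>y\<in>Obj B. \<forall>z\<in>Obj B.
         is_nat_iso (prod_cat (H y z) (prod_cat (H x y) (H w x))) (H w z)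
           (\<lambda>(h, g, f). c1 w x z (c1 x y z h g) f) (\<lambda>(\<gamma>, \<beta>, \<alpha>). c2 w x z (c2 x y z \<gamma> \<beta>) \<alpha>)
           (\<lambda>(h, g, f). c1 w y z h (c1 w x y g f)) (\<lambda>(\<gamma>, \<beta>, \<alpha>). c2 w y z \<gamma> (c2 w x y \<beta> \<alpha>))
           (\<lambda>(h, g, f). a w x y z h g f)) \<and>
      (\<forall>x\<in>Obj B. \<forall>y\<in>Obj B.
         is_nat_iso (H x y) (H x y)
           (\<lambda>f. c1 x y y (I y) f) (\<lambda>\<alpha>. c2 x y y (Idt (H y y) (I y)) \<alpha>) (\<lambda>f. f) (\<lambda>\<alpha>. \<alpha>)
           (lunit B x y) \<and>
         is_nat_iso (H x y) (H x y)
           (\<lambda>f. c1 x x y f (I x)) (\<lambda>\<alpha>. c2 x x y \<alpha> (Idt (H x x) (I x))) (\<lambda>f. f) (\<lambda>\<alpha>. \<alpha>)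
           (runit B x y)) \<and>
      (\<forall>v\<in>Obj B. \<forall>w\<in>Obj B. \<forall>x\<in>Obj B. \<forall>y\<in>Obj B. \<forall>z\<in>Obj B.
       \<forall>k\<in>Ob (H y z). \<forall>h\<in>Ob (H x y). \<forall>g\<in>Ob (H w x). \<forall>f\<in>Ob (H v w).
         Comp (H v z) (a v w y z k h (c1 v w x g f)) (a v w x z (c1 x y z k h) g f) =
         Comp (H v z) (c2 v y z (Idt (H y z) k) (a v w x y h g f))
           (Comp (H v z) (a v w y z k (c1 w x y h g) f)
             (c2 v w z (a w x y z k h g) (Idt (H v w) f)))) \<and>
      (\<forall>x\<in>Obj B. \<forall>y\<in>Obj B. \<forall>z\<in>Obj B. \<forall>g\<in>Ob (H y z). \<forall>f\<in>Ob (H x y).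
         Comp (H x z) (c2 x y z (Idt (H y z) g) (lunit B x y f)) (a x y y z g (I y) f) =
         c2 x y z (runit B y z g) (Idt (H x y) f)))"


section \<open>The bicategory over a point\<close>

definition fibre_hom ::
  "('q, 'eq, 'y, 'ey, 'x, 'ex, 'm, 'em) bundle_2_gerbe_data \<Rightarrow> 'x \<Rightarrow> 'x \<Rightarrow> ('y, 'q) cat_data" where
  "fibre_hom D x x' =
     \<lparr>Ob = yfibre D x x', Arr = qfibre D, Idt = gid (gerbe D), Comp = qmult D\<rparr>"

definition fibre_bicat ::
  "('q, 'eq, 'y, 'ey, 'x, 'ex, 'm, 'em) bundle_2_gerbe_data \<Rightarrow> 'm \<Rightarrow> ('x \<Rightarrow> 'y) \<Rightarrow>
   ('x \<Rightarrow> 'x \<Rightarrow> 'y \<Rightarrow> 'q) \<Rightarrow> ('x \<Rightarrow> 'x \<Rightarrow> 'y \<Rightarrow> 'q) \<Rightarrow> ('x, 'y, 'q) bicat_data" where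
  "fibre_bicat D m \<iota> l r =
     \<lparr>Obj = {x \<in> pts (space D). proj D x = m},
      HomCat = fibre_hom D,
      hcomp1 = (\<lambda>_ _ _. mcomp D),
      hcomp2 = (\<lambda>_ _ _. mhat D),
      unit1 = \<iota>,
      assoc = (\<lambda>_ _ _ _. ahat D),
      lunit = l,
      runit = r\<rparr>"

definition diagonal_section ::
  "('q, 'eq, 'y, 'ey, 'x, 'ex, 'm, 'em) bundle_2_gerbe_data \<Rightarrow> ('x \<Rightarrow> 'y) \<Rightarrow> bool" where
  "diagonal_section D \<iota> \<longleftrightarrow> (\<forall>x\<in>pts (space D). \<iota> x \<in> yfibre D x x)"

end

theory Submission
  imports Defs
begin

text \<open>
  Every fibre \<open>Q\<^bsub>(y, y')\<^esub>\<close> is a \<open>\<complex>\<^sup>\<times>\<close>-torsor, by local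
  triviality, and all the operations of a bundle 2-gerbe are equivariant. An equivariant map
  between two such torsors is a bijection (\<open>equivariant_bijective\<close>). Applied to the
  gerbe product this makes the points of \<open>Q\<close> the arrows of a groupoid: a product with a
  fixed arrow can be cancelled and divided by, so identities and inverses exist, and the only
  idempotents are the identities. In particular \<open>mhat\<close> preserves identities, and every
  transformation is a natural isomorphism. The associator is natural because it is a
  transformation, and the pentagon is the coherency condition with its inverses moved to the
  other side.

  What has to be constructed are the unit constraints. Any two points of
  \<open>Y\<^bsub>(x, x)\<^esub>\<close> are joined by a 2-arrow, so for every \<open>x\<close> there is some
  \<open>u : \<iota> \<iota> \<Rightarrow> \<iota>\<close>, where \<open>\<iota>\<close> is the chosen point over
  \<open>(x, x)\<close>. Applied to \<open>mhat\<close>, the same bijectivity says that composing with a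
  fixed 2-arrow along the base is bijective on the 2-arrows between two given 1-arrows. Hence
  there are unique 2-arrows
  \<open>l f : \<iota> f \<Rightarrow> f\<close> and \<open>r g : g \<iota> \<Rightarrow> g\<close> with
  \<open>\<iota> \<star> l f = (u \<star> f) \<cdot> a(\<iota>, \<iota>, f)\<inverse>\<close> and
  \<open>r g \<star> \<iota> = (g \<star> u) \<cdot> a(g, \<iota>, \<iota>)\<close>.
  Their naturality follows from that of the associator by cancelling \<open>\<iota>\<close>. With the
  same \<open>u\<close> in both equations, the pentagon for \<open>g, \<iota>, \<iota>, f\<close> contains
  both sides of the triangle identity (\<open>triangle\<close>), and a cancellation isolates them.
  The section \<open>\<iota>\<close> itself exists because \<open>Y\<close> maps onto the whole fibre
  square of \<open>X\<close>, the diagonal included.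
\<close>

section \<open>Bundle gerbes as torsors\<close>

lemma smooth_map_pts: "smooth_map A B f \<Longrightarrow> p \<in> pts A \<Longrightarrow> f p \<in> pts B"
  unfolding smooth_map_def by blast

text \<open>
  Points of the total space are treated as arrows with a source and a target, instead of as
  members of indexed fibres: the conditions for composing are then equations that the simplifier
  decides.
\<close>

locale gerbe_fibres =
  fixes G :: "('p, 'ep::banach, 'z, 'ez::banach, 'n, 'en::banach) bundle_gerbe_data"
  assumes bundle_gerbe: "bundle_gerbe G"
begin

definition arrow :: "'p \<Rightarrow> bool" where "arrow p \<longleftrightarrow> p \<in> pts (total_space G)"
definition src :: "'p \<Rightarrow> 'z" where "src p = fst (bundle_proj G p)"
definition tgt :: "'p \<Rightarrow> 'z" where "tgt p = snd (bundle_proj G p)"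
definition point :: "'z \<Rightarrow> bool" where "point z \<longleftrightarrow> z \<in> pts (cover G)"

abbreviation vcomp :: "'p \<Rightarrow> 'p \<Rightarrow> 'p" (infixr "\<cdot>" 70) where "p \<cdot> q \<equiv> gmult G p q"
abbreviation rescale :: "complex \<Rightarrow> 'p \<Rightarrow> 'p" where "rescale \<equiv> cact G"
abbreviation ident :: "'z \<Rightarrow> 'p" where "ident \<equiv> gid G"
abbreviation inver :: "'p \<Rightarrow> 'p" where "inver \<equiv> ginv G"

lemma gfibre_iff: "p \<in> gfibre G z z' \<longleftrightarrow> arrow p \<and> src p = z \<and> tgt p = z'"
  by (auto simp: gfibre_def arrow_def src_def tgt_def prod_eq_iff)

lemma cover_principal:
  "principal_Cstar_bundle (total_space G) (fibre_square (cover G) (cover_proj G))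
     (bundle_proj G) (cact G)"
  using bundle_gerbe by (simp add: bundle_gerbe_def)

lemma pts_fibre_square:
  "(z, z') \<in> pts (fibre_square (cover G) (cover_proj G)) \<longleftrightarrow>
     point z \<and> point z' \<and> cover_proj G z = cover_proj G z'"
  by (auto simp: fibre_square_def subspace_of_def prod_space_def point_def)

lemma arrow_endpoints:
  assumes "arrow p"
  shows "point (src p)" "point (tgt p)" "cover_proj G (tgt p) = cover_proj G (src p)"
proof -
  have "smooth_map (total_space G) (fibre_square (cover G) (cover_proj G)) (bundle_proj G)"
    using cover_principal unfolding principal_Cstar_bundle_def by (elim conjE)
  then have "bundle_proj G p \<in> pts (fibre_square (cover G) (cover_proj G))"
    by (rule smooth_map_pts) (use assms in \<open>simp add: arrow_def\<close>)
  then have "(src p, tgt p) \<in> pts (fibre_square (cover G) (cover_proj G))"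
    by (simp add: src_def tgt_def)
  then show "point (src p)" "point (tgt p)" "cover_proj G (tgt p) = cover_proj G (src p)"
    by (auto simp: pts_fibre_square)
qed

lemma rescale_arrow:
  assumes "arrow p" "c \<noteq> 0"
  shows "arrow (rescale c p)" "src (rescale c p) = src p" "tgt (rescale c p) = tgt p"
proof -
  have action: "smooth_map (prod_space Cstar (total_space G)) (total_space G) (\<lambda>(c, p). rescale c p)"
    and "\<forall>c. \<forall>p\<in>pts (total_space G). c \<noteq> 0 \<longrightarrow> bundle_proj G (rescale c p) = bundle_proj G p"
    using cover_principal unfolding principal_Cstar_bundle_def by - ((elim conjE, assumption)+)
  then have "bundle_proj G (rescale c p) = bundle_proj G p"
    using assms unfolding arrow_def by metis
  then show "src (rescale c p) = src p" "tgt (rescale c p) = tgt p"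
    by (simp_all add: src_def tgt_def)
  have "(c, p) \<in> pts (prod_space Cstar (total_space G))"
    using assms by (simp add: prod_space_def Cstar_def arrow_def)
  from smooth_map_pts[OF action this] show "arrow (rescale c p)"
    by (simp add: arrow_def)
qed

text \<open>
  A local trivialisation restricted to one fibre is an equivariant parametrisation of that fibre by
  the non-zero complex numbers.
\<close>

lemma local_trivialisation:
  assumes "point z" "point z'" "cover_proj G z = cover_proj G z'"
  obtains \<phi> where
    "\<And>c. c \<noteq> 0 \<Longrightarrow> arrow (\<phi> c) \<and> src (\<phi> c) = z \<and> tgt (\<phi> c) = z'"
    "\<And>p. arrow p \<Longrightarrow> src p = z \<Longrightarrow> tgt p = z' \<Longrightarrow> \<exists>c. c \<noteq> 0 \<and> p = \<phi> c"
    "\<And>c d. c \<noteq> 0 \<Longrightarrow> d \<noteq> 0 \<Longrightarrow> \<phi> (c * d) = rescale c (\<phi> d)"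
    "\<And>c d. c \<noteq> 0 \<Longrightarrow> d \<noteq> 0 \<Longrightarrow> \<phi> c = \<phi> d \<Longrightarrow> c = d"
proof -
  let ?B = "fibre_square (cover G) (cover_proj G)"
  let ?P = "total_space G"
  let ?pr = "bundle_proj G"
  have b: "(z, z') \<in> pts ?B" using assms by (simp add: pts_fibre_square)
  obtain V \<phi> \<psi> where V: "(z, z') \<in> V"
    and \<phi>: "smooth_map (prod_space (subspace_of ?B V) Cstar) (subspace_of ?P (?pr -` V)) \<phi>"
    and \<psi>: "smooth_map (subspace_of ?P (?pr -` V)) (prod_space (subspace_of ?B V) Cstar) \<psi>"
    and \<psi>\<phi>: "\<forall>u\<in>pts (prod_space (subspace_of ?B V) Cstar). \<psi> (\<phi> u) = u \<and> ?pr (\<phi> u) = fst u"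
    and \<phi>\<psi>: "\<forall>p\<in>pts (subspace_of ?P (?pr -` V)). \<phi> (\<psi> p) = p"
    and eqv: "\<forall>b'\<in>pts (subspace_of ?B V). \<forall>c d. c \<noteq> 0 \<longrightarrow> d \<noteq> 0 \<longrightarrow>
           \<phi> (b', c * d) = rescale c (\<phi> (b', d))"
    using cover_principal b unfolding principal_Cstar_bundle_def
    by (elim conjE) (drule (1) bspec, elim exE conjE, rule that)
  note \<psi>\<phi> = bspec[OF \<psi>\<phi>] and \<phi>\<psi> = bspec[OF \<phi>\<psi>]
  have bV: "(z, z') \<in> pts (subspace_of ?B V)"
    using b V by (simp add: subspace_of_def)
  have u: "((z, z'), c) \<in> pts (prod_space (subspace_of ?B V) Cstar)" if "c \<noteq> 0" for c
    using bV that by (simp add: prod_space_def Cstar_def)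
  show thesis
  proof (rule that[of "\<lambda>c. \<phi> ((z, z'), c)"])
    fix c :: complex assume c: "c \<noteq> 0"
    have "\<phi> ((z, z'), c) \<in> pts (subspace_of ?P (?pr -` V))"
      using smooth_map_pts[OF \<phi> u[OF c]] .
    then show "arrow (\<phi> ((z, z'), c)) \<and> src (\<phi> ((z, z'), c)) = z \<and> tgt (\<phi> ((z, z'), c)) = z'"
      using \<psi>\<phi>[OF u[OF c]] by (simp add: arrow_def src_def tgt_def subspace_of_def)
  next
    fix p assume p: "arrow p" "src p = z" "tgt p = z'"
    have pr: "?pr p = (z, z')" using p by (simp add: src_def tgt_def prod_eq_iff)
    have pV: "p \<in> pts (subspace_of ?P (?pr -` V))"
      using p V pr by (simp add: arrow_def subspace_of_def)
    have \<psi>p: "\<psi> p \<in> pts (prod_space (subspace_of ?B V) Cstar)"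
      using smooth_map_pts[OF \<psi> pV] .
    then have "fst (\<psi> p) = (z, z')" using \<psi>\<phi>[OF \<psi>p] \<phi>\<psi>[OF pV] pr by simp
    moreover have "snd (\<psi> p) \<noteq> 0" using \<psi>p by (simp add: prod_space_def Cstar_def mem_Times_iff)
    moreover have "p = \<phi> (fst (\<psi> p), snd (\<psi> p))" using \<phi>\<psi>[OF pV] by simp
    ultimately show "\<exists>c. c \<noteq> 0 \<and> p = \<phi> ((z, z'), c)" by auto
  next
    fix c d :: complex assume "c \<noteq> 0" "d \<noteq> 0"
    then show "\<phi> ((z, z'), c * d) = rescale c (\<phi> ((z, z'), d))" by (rule eqv[rule_format, OF bV])
  next
    fix c d :: complex assume cd: "c \<noteq> 0" "d \<noteq> 0" and eq: "\<phi> ((z, z'), c) = \<phi> ((z, z'), d)"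
    have "((z, z'), c) = \<psi> (\<phi> ((z, z'), c))" by (rule conjunct1[OF \<psi>\<phi>[OF u[OF cd(1)]], symmetric])
    also have "\<dots> = ((z, z'), d)" unfolding eq by (rule conjunct1[OF \<psi>\<phi>[OF u[OF cd(2)]]])
    finally show "c = d" by simp
  qed
qed

lemma arrow_exists:
  assumes "point z" "point z'" "cover_proj G z = cover_proj G z'"
  obtains p where "arrow p" "src p = z" "tgt p = z'"
proof -
  obtain \<phi> where "\<And>c::complex. c \<noteq> 0 \<Longrightarrow> arrow (\<phi> c) \<and> src (\<phi> c) = z \<and> tgt (\<phi> c) = z'"
    by (rule local_trivialisation[OF assms]) (rule that)
  from this[of 1] show thesis using that by auto
qed

lemma parallel_arrows_rescale:
  assumes "arrow p" "arrow q" "src q = src p" "tgt q = tgt p"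
  shows "\<exists>!c. c \<noteq> 0 \<and> q = rescale c p"
proof -
  obtain \<phi> where
    "\<And>c. c \<noteq> 0 \<Longrightarrow> arrow (\<phi> c) \<and> src (\<phi> c) = src p \<and> tgt (\<phi> c) = tgt p" and
    ex: "\<And>q. arrow q \<Longrightarrow> src q = src p \<Longrightarrow> tgt q = tgt p \<Longrightarrow> \<exists>c. c \<noteq> 0 \<and> q = \<phi> c" and
    eqv: "\<And>c d. c \<noteq> 0 \<Longrightarrow> d \<noteq> 0 \<Longrightarrow> \<phi> (c * d) = rescale c (\<phi> d)" and
    inj: "\<And>c d. c \<noteq> 0 \<Longrightarrow> d \<noteq> 0 \<Longrightarrow> \<phi> c = \<phi> d \<Longrightarrow> c = d"
    by (rule local_trivialisation[OF arrow_endpoints(1,2)[OF assms(1)] arrow_endpoints(3)[OF assms(1), symmetric]])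
      (rule that)
  obtain c d where cd: "c \<noteq> 0" "p = \<phi> c" "d \<noteq> 0" "q = \<phi> d"
    using ex[of p] ex[of q] assms by blast
  show ?thesis
  proof (rule ex1I[of _ "d / c"])
    show "d / c \<noteq> 0 \<and> q = rescale (d / c) p"
      using cd eqv[of "d / c" c] by simp
  next
    fix k assume k: "k \<noteq> 0 \<and> q = rescale k p"
    then have "\<phi> (k * c) = \<phi> d" using cd eqv[of k c] by simp
    then have "k * c = d" using inj[of "k * c" d] k cd by simp
    then show "k = d / c" using cd by (simp add: field_simps)
  qed
qed

text \<open>
  Non-zero scalars act simply transitively on source and target, so \<open>r\<close> is
  \<open>c\<close> times the image of a chosen point for exactly one \<open>c\<close>, and by
  equivariance \<open>c\<close> times that point is the only preimage. The cancellation and division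
  rules below are instances, with \<open>f\<close> a product with a fixed arrow.
\<close>

lemma equivariant_bijective:
  assumes z: "point z1" "point z2" "cover_proj G z1 = cover_proj G z2"
    and maps: "\<And>p. arrow p \<Longrightarrow> src p = z1 \<Longrightarrow> tgt p = z2 \<Longrightarrow>
      arrow (f p) \<and> src (f p) = src r \<and> tgt (f p) = tgt r"
    and eqv: "\<And>c p. c \<noteq> 0 \<Longrightarrow> arrow p \<Longrightarrow> src p = z1 \<Longrightarrow> tgt p = z2 \<Longrightarrow> f (rescale c p) = rescale c (f p)"
    and r: "arrow r"
  shows "\<exists>!p. arrow p \<and> src p = z1 \<and> tgt p = z2 \<and> f p = r"
proof -
  obtain p where p: "arrow p" "src p = z1" "tgt p = z2" using arrow_exists[OF z] .
  obtain c where c: "c \<noteq> 0" "r = rescale c (f p)"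
    and uniq: "\<And>d. d \<noteq> 0 \<Longrightarrow> r = rescale d (f p) \<Longrightarrow> d = c"
    using parallel_arrows_rescale[of "f p" r] maps[OF p] r by metis
  show ?thesis
  proof (rule ex1I[of _ "rescale c p"])
    show "arrow (rescale c p) \<and> src (rescale c p) = z1 \<and> tgt (rescale c p) = z2 \<and> f (rescale c p) = r"
      using p c rescale_arrow[of p c] eqv[of c p] by simp
  next
    fix q assume q: "arrow q \<and> src q = z1 \<and> tgt q = z2 \<and> f q = r"
    then obtain d where d: "d \<noteq> 0" "q = rescale d p"
      using parallel_arrows_rescale[of p q] p by auto
    then have "d = c" using uniq[of d] eqv[of d p] q p by simp
    then show "q = rescale c p" using d by simp
  qed
qed


section \<open>Identities and inverses\<close>

lemma gmult_fibrewise: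
  assumes "p \<in> gfibre G z2 z3" "q \<in> gfibre G z1 z2"
  shows "p \<cdot> q \<in> gfibre G z1 z3 \<and>
    (\<forall>c. c \<noteq> 0 \<longrightarrow> rescale c p \<cdot> q = rescale c (p \<cdot> q) \<and> p \<cdot> rescale c q = rescale c (p \<cdot> q))"
proof -
  have "\<forall>z1 z2 z3. \<forall>p23\<in>gfibre G z2 z3. \<forall>p12\<in>gfibre G z1 z2. p23 \<cdot> p12 \<in> gfibre G z1 z3 \<and>
    (\<forall>c. c \<noteq> 0 \<longrightarrow> rescale c p23 \<cdot> p12 = rescale c (p23 \<cdot> p12) \<and> p23 \<cdot> rescale c p12 = rescale c (p23 \<cdot> p12))"
    using bundle_gerbe unfolding bundle_gerbe_def by (elim conjE)
  from this[THEN spec, THEN spec, THEN spec, THEN bspec, OF assms(1), THEN bspec, OF assms(2)]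
  show ?thesis .
qed

lemma vcomp_arrow:
  assumes "arrow p" "arrow q" "src p = tgt q"
  shows "arrow (p \<cdot> q)" "src (p \<cdot> q) = src q" "tgt (p \<cdot> q) = tgt p"
  using gmult_fibrewise[of p "tgt q" "tgt p" q "src q"] assms by (auto simp: gfibre_iff)

lemma vcomp_rescale:
  assumes "arrow p" "arrow q" "src p = tgt q" "c \<noteq> 0"
  shows "rescale c p \<cdot> q = rescale c (p \<cdot> q)" "p \<cdot> rescale c q = rescale c (p \<cdot> q)"
  using gmult_fibrewise[of p "tgt q" "tgt p" q "src q"] assms by (auto simp: gfibre_iff)

lemma vcomp_assoc:
  assumes "arrow p" "arrow q" "arrow r" "src p = tgt q" "src q = tgt r"
  shows "(p \<cdot> q) \<cdot> r = p \<cdot> q \<cdot> r"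
proof -
  have p: "p \<in> gfibre G (tgt q) (tgt p)" "q \<in> gfibre G (tgt r) (tgt q)" "r \<in> gfibre G (src r) (tgt r)"
    using assms by (simp_all add: gfibre_iff)
  have "\<forall>z1 z2 z3 z4. \<forall>p34\<in>gfibre G z3 z4. \<forall>p23\<in>gfibre G z2 z3. \<forall>p12\<in>gfibre G z1 z2.
        p34 \<cdot> p23 \<cdot> p12 = (p34 \<cdot> p23) \<cdot> p12"
    using bundle_gerbe unfolding bundle_gerbe_def by (elim conjE)
  from this[rule_format, OF p] show ?thesis by (rule sym)
qed

lemma vcomp_left_bijective:
  assumes "arrow p" "arrow r" "tgt r = tgt p"
  shows "\<exists>!q. arrow q \<and> src q = src r \<and> tgt q = src p \<and> p \<cdot> q = r"
  by (rule equivariant_bijective)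
    (use assms arrow_endpoints[of p] arrow_endpoints[of r] in \<open>simp_all add: vcomp_arrow vcomp_rescale\<close>)

lemma vcomp_right_bijective:
  assumes "arrow q" "arrow r" "src r = src q"
  shows "\<exists>!p. arrow p \<and> src p = tgt q \<and> tgt p = tgt r \<and> p \<cdot> q = r"
  by (rule equivariant_bijective)
    (use assms arrow_endpoints[of q] arrow_endpoints[of r] in \<open>simp_all add: vcomp_arrow vcomp_rescale\<close>)

lemma vcomp_left_cancel:
  assumes "p \<cdot> q = p \<cdot> q'" "arrow p" "arrow q" "arrow q'"
    "src p = tgt q" "tgt q' = tgt q" "src q' = src q"
  shows "q = q'"
  using vcomp_left_bijective[of p "p \<cdot> q"] assms vcomp_arrow by metis

lemma vcomp_right_cancel:
  assumes "p \<cdot> q = p' \<cdot> q" "arrow q" "arrow p" "arrow p'"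
    "src p = tgt q" "src p' = src p" "tgt p' = tgt p"
  shows "p = p'"
  using vcomp_right_bijective[of q "p \<cdot> q"] assms vcomp_arrow by metis

text \<open>
  The identity is found by dividing an arbitrary loop by itself; that it is neutral for every
  other arrow follows by cancelling this loop.
\<close>

lemma ident_unique_existence:
  assumes "point z"
  shows "\<exists>!e. e \<in> gfibre G z z \<and>
     (\<forall>z'. (\<forall>p\<in>gfibre G z' z. e \<cdot> p = p) \<and> (\<forall>p\<in>gfibre G z z'. p \<cdot> e = p))"
proof -
  obtain p0 where p0: "arrow p0" "src p0 = z" "tgt p0 = z"
    using arrow_exists[of z z] assms by auto
  obtain e where e: "arrow e" "src e = z" "tgt e = z" "p0 \<cdot> e = p0"
    using vcomp_left_bijective[of p0 p0] p0 by auto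
  have left: "e \<cdot> p = p" if p: "arrow p" "tgt p = z" for p
    by (rule vcomp_left_cancel[of p0])
      (use p0 e p in \<open>simp_all add: vcomp_arrow flip: vcomp_assoc\<close>)
  have right: "p \<cdot> e = p" if p: "arrow p" "src p = z" for p
    by (rule vcomp_right_cancel[of _ p0])
      (use p0 e p in \<open>simp_all add: vcomp_arrow vcomp_assoc left\<close>)
  show ?thesis
  proof (rule ex1I[of _ e])
    show "e \<in> gfibre G z z \<and>
     (\<forall>z'. (\<forall>p\<in>gfibre G z' z. e \<cdot> p = p) \<and> (\<forall>p\<in>gfibre G z z'. p \<cdot> e = p))"
      using e left right by (simp add: gfibre_iff)
  next
    fix e' assume "e' \<in> gfibre G z z \<and>
     (\<forall>z'. (\<forall>p\<in>gfibre G z' z. e' \<cdot> p = p) \<and> (\<forall>p\<in>gfibre G z z'. p \<cdot> e' = p))"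
    then show "e' = e" using e left by (metis gfibre_iff)
  qed
qed

lemma ident_props:
  assumes "point z"
  shows "ident z \<in> gfibre G z z \<and>
     (\<forall>z'. (\<forall>p\<in>gfibre G z' z. ident z \<cdot> p = p) \<and> (\<forall>p\<in>gfibre G z z'. p \<cdot> ident z = p))"
  using theI'[OF ident_unique_existence[OF assms]] by (simp add: gid_def)

lemma ident_arrow:
  assumes "point z"
  shows "arrow (ident z)" "src (ident z) = z" "tgt (ident z) = z"
  using ident_props[OF assms] by (simp_all add: gfibre_iff)

lemma ident_neutral:
  assumes "arrow p"
  shows "tgt p = z \<Longrightarrow> ident z \<cdot> p = p" "src p = z \<Longrightarrow> p \<cdot> ident z = p"
  using ident_props[of "tgt p"] ident_props[of "src p"] arrow_endpoints[OF assms] assms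
  by (auto simp: gfibre_iff)

text \<open>
  This is how arrows are recognised as identities: the other half of an inverse, and the composite
  of two identities along the base.
\<close>

lemma idempotent_is_ident:
  assumes "arrow p" "src p = z" "tgt p = z" "p \<cdot> p = p"
  shows "p = ident z"
  by (rule vcomp_left_cancel[of p])
    (use assms arrow_endpoints[of p] in \<open>auto simp: ident_neutral ident_arrow\<close>)

lemma inver_props:
  assumes "arrow p"
  shows "arrow (inver p)" "src (inver p) = tgt p" "tgt (inver p) = src p"
    "inver p \<cdot> p = ident (src p)" "p \<cdot> inver p = ident (tgt p)"
proof -
  note [simp] = vcomp_arrow vcomp_assoc ident_neutral ident_arrow arrow_endpoints
  obtain q where q: "arrow q" "src q = tgt p" "tgt q = src p" "q \<cdot> p = ident (src p)"
    using vcomp_right_bijective[of p "ident (src p)"] assms by auto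
  have "q \<cdot> p \<cdot> q = (q \<cdot> p) \<cdot> q" using assms q(1-3) by simp
  then have qpq: "q \<cdot> p \<cdot> q = q" using assms q by (simp del: vcomp_assoc)
  have pq: "p \<cdot> q = ident (tgt p)"
    by (rule idempotent_is_ident) (use assms q qpq in simp_all)
  let ?inverse = "\<lambda>p'. p' \<in> gfibre G (tgt p) (src p) \<and>
      p' \<cdot> p = ident (src p) \<and> p \<cdot> p' = ident (tgt p)"
  have "\<exists>!p'. ?inverse p'"
  proof (rule ex1I[of _ q])
    show "?inverse q" using q pq by (simp add: gfibre_iff)
    show "p' = q" if "?inverse p'" for p'
      by (rule vcomp_left_cancel[of p]) (use that assms q pq in \<open>auto simp: gfibre_iff\<close>)
  qed
  from theI'[OF this] have "?inverse (inver p)"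
    by (simp add: ginv_def src_def tgt_def)
  then show "arrow (inver p)" "src (inver p) = tgt p" "tgt (inver p) = src p"
    "inver p \<cdot> p = ident (src p)" "p \<cdot> inver p = ident (tgt p)"
    by (auto simp: gfibre_iff)
qed

lemma move_inver:
  assumes "inver p \<cdot> q = r" "arrow p" "arrow q" "tgt q = tgt p"
  shows "q = p \<cdot> r"
  using assms by (simp add: inver_props ident_neutral vcomp_arrow flip: assms(1) vcomp_assoc)

end


section \<open>Composition along the base\<close>

locale two_gerbe_fibres =
  fixes D :: "('q, 'eq::banach, 'y, 'ey::banach, 'x, 'ex::banach, 'm, 'em::banach) bundle_2_gerbe_data"
  assumes bundle_2_gerbe: "bundle_2_gerbe D"
begin

sublocale gerbe_fibres "gerbe D"
  using bundle_2_gerbe by unfold_locales (simp add: bundle_2_gerbe_def)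

notation vcomp (infixr "\<cdot>" 70)

abbreviation ysrc :: "'y \<Rightarrow> 'x" where "ysrc y \<equiv> fst (cover_proj (gerbe D) y)"
abbreviation ytgt :: "'y \<Rightarrow> 'x" where "ytgt y \<equiv> snd (cover_proj (gerbe D) y)"
abbreviation hcomp :: "'y \<Rightarrow> 'y \<Rightarrow> 'y" (infixr "\<odot>" 75) where "y \<odot> y' \<equiv> mcomp D y y'"
abbreviation hcomp' :: "'q \<Rightarrow> 'q \<Rightarrow> 'q" (infixr "\<star>" 75) where "q \<star> q' \<equiv> mhat D q q'"
abbreviation associator :: "'y \<Rightarrow> 'y \<Rightarrow> 'y \<Rightarrow> 'q" where "associator \<equiv> ahat D"

lemma structure_axioms:
  shows composition_axioms: "composition_morphism D"
    and associator_axioms: "associator_transformation D"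
    and coherence_axioms: "associator_coherent D"
  using bundle_2_gerbe unfolding bundle_2_gerbe_def by auto

lemmas composition_axiom = composition_axioms[unfolded composition_morphism_def, THEN conjunct2]
lemmas mcomp_axiom = composition_axiom[THEN conjunct1, rule_format]
lemmas mhat_axiom = composition_axiom[THEN conjunct2, THEN conjunct2, THEN conjunct1, rule_format]
lemmas interchange_axiom = composition_axiom[THEN conjunct2, THEN conjunct2, THEN conjunct2, rule_format]
lemmas associator_axiom = associator_axioms[unfolded associator_transformation_def, THEN conjunct2]
lemmas ahat_axiom = associator_axiom[THEN conjunct1, rule_format]
lemmas naturality_axiom = associator_axiom[THEN conjunct2, rule_format]
lemmas pentagon_axiom = coherence_axioms[unfolded associator_coherent_def Let_def, rule_format]

lemma yfibre_iff: "y \<in> yfibre D x x' \<longleftrightarrow> point y \<and> ysrc y = x \<and> ytgt y = x'"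
  by (auto simp: yfibre_def point_def prod_eq_iff)

lemma arrow_cover_proj:
  assumes "arrow q"
  shows "ysrc (tgt q) = ysrc (src q)" "ytgt (tgt q) = ytgt (src q)"
  using arrow_endpoints(3)[OF assms] by simp_all

lemma hcomp_point:
  assumes "point g" "point f" "ysrc g = ytgt f"
  shows "point (g \<odot> f)" "cover_proj (gerbe D) (g \<odot> f) = (ysrc f, ytgt g)"
proof -
  have "g \<odot> f \<in> yfibre D (ysrc f) (ytgt g)"
    by (rule mcomp_axiom) (use assms in \<open>simp_all add: yfibre_iff\<close>)
  then show "point (g \<odot> f)" "cover_proj (gerbe D) (g \<odot> f) = (ysrc f, ytgt g)"
    by (auto simp: yfibre_iff prod_eq_iff)
qed

lemma composition_fibrewise:
  assumes "arrow q" "arrow p" "ysrc (src q) = ytgt (src p)"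
  shows "q \<star> p \<in> qfibre D (src q \<odot> src p) (tgt q \<odot> tgt p)"
    "c \<noteq> 0 \<Longrightarrow> rescale c q \<star> p = rescale c (q \<star> p) \<and> q \<star> rescale c p = rescale c (q \<star> p)"
proof -
  let ?x1 = "ysrc (src p)" let ?x2 = "ytgt (src p)" let ?x3 = "ytgt (src q)"
  have y: "src q \<in> yfibre D ?x2 ?x3" "tgt q \<in> yfibre D ?x2 ?x3"
    "src p \<in> yfibre D ?x1 ?x2" "tgt p \<in> yfibre D ?x1 ?x2"
    and f: "q \<in> qfibre D (src q) (tgt q)" "p \<in> qfibre D (src p) (tgt p)"
    using assms by (simp_all add: yfibre_iff gfibre_iff arrow_endpoints arrow_cover_proj)
  show "q \<star> p \<in> qfibre D (src q \<odot> src p) (tgt q \<odot> tgt p)"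
    using mhat_axiom[OF y f] by (rule conjunct1)
  show "rescale c q \<star> p = rescale c (q \<star> p) \<and> q \<star> rescale c p = rescale c (q \<star> p)" if "c \<noteq> 0"
    using mhat_axiom[OF y f] that by blast
qed

lemma hcomp_arrow:
  assumes "arrow q" "arrow p" "ysrc (src q) = ytgt (src p)"
  shows "arrow (q \<star> p)" "src (q \<star> p) = src q \<odot> src p" "tgt (q \<star> p) = tgt q \<odot> tgt p"
  using composition_fibrewise(1)[OF assms] by (auto simp: gfibre_iff)

lemma interchange:
  assumes "arrow q" "arrow q'" "arrow p" "arrow p'"
    "src q' = tgt q" "src p' = tgt p" "ysrc (src q) = ytgt (src p)"
  shows "(q' \<cdot> q) \<star> (p' \<cdot> p) = (q' \<star> p') \<cdot> (q \<star> p)"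
proof -
  let ?x1 = "ysrc (src p)" let ?x2 = "ytgt (src p)" let ?x3 = "ytgt (src q)"
  have y: "src q \<in> yfibre D ?x2 ?x3" "tgt q \<in> yfibre D ?x2 ?x3" "tgt q' \<in> yfibre D ?x2 ?x3"
    "src p \<in> yfibre D ?x1 ?x2" "tgt p \<in> yfibre D ?x1 ?x2" "tgt p' \<in> yfibre D ?x1 ?x2"
    and f: "q \<in> qfibre D (src q) (tgt q)" "q' \<in> qfibre D (tgt q) (tgt q')"
      "p \<in> qfibre D (src p) (tgt p)" "p' \<in> qfibre D (tgt p) (tgt p')"
    using assms arrow_cover_proj[of q'] arrow_cover_proj[of p']
    by (simp_all add: yfibre_iff gfibre_iff arrow_endpoints arrow_cover_proj)
  show ?thesis by (rule interchange_axiom[OF y f])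
qed

text \<open>By interchange the composite of two identities is idempotent.\<close>

lemma hcomp_ident:
  assumes "point g" "point f" "ysrc g = ytgt f"
  shows "ident g \<star> ident f = ident (g \<odot> f)"
  by (rule idempotent_is_ident)
    (use assms in \<open>simp_all add: hcomp_arrow ident_arrow ident_neutral flip: interchange\<close>)

text \<open>
  Composition along the base with a fixed 2-arrow is again an equivariant map of torsors. The
  unit constraints are defined by means of this and the next lemma.
\<close>

lemma hcomp_left_bijective:
  assumes "arrow q" "arrow r" "point f" "point f'" "cover_proj (gerbe D) f = cover_proj (gerbe D) f'"
    "ysrc (src q) = ytgt f" "src r = src q \<odot> f" "tgt r = tgt q \<odot> f'"
  shows "\<exists>!p. arrow p \<and> src p = f \<and> tgt p = f' \<and> q \<star> p = r"
  by (rule equivariant_bijective)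
    (use assms in \<open>simp_all add: hcomp_arrow composition_fibrewise(2)\<close>)

lemma hcomp_right_bijective:
  assumes "arrow p" "arrow r" "point g" "point g'" "cover_proj (gerbe D) g = cover_proj (gerbe D) g'"
    "ysrc g = ytgt (src p)" "src r = g \<odot> src p" "tgt r = g' \<odot> tgt p"
  shows "\<exists>!q. arrow q \<and> src q = g \<and> tgt q = g' \<and> q \<star> p = r"
  by (rule equivariant_bijective)
    (use assms in \<open>simp_all add: hcomp_arrow composition_fibrewise(2)\<close>)

lemma hcomp_left_cancel:
  assumes "q \<star> p = q \<star> p'" "arrow q" "arrow p" "arrow p'"
    "ysrc (src q) = ytgt (src p)" "src p' = src p" "tgt p' = tgt p"
  shows "p = p'"
proof -
  have "\<exists>!x. arrow x \<and> src x = src p \<and> tgt x = tgt p \<and> q \<star> x = q \<star> p"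
    by (rule hcomp_left_bijective) (use assms in \<open>simp_all add: hcomp_arrow arrow_endpoints\<close>)
  then show ?thesis using assms by metis
qed

lemma hcomp_right_cancel:
  assumes "q \<star> p = q' \<star> p" "arrow p" "arrow q" "arrow q'"
    "ysrc (src q) = ytgt (src p)" "src q' = src q" "tgt q' = tgt q"
  shows "q = q'"
proof -
  have "\<exists>!x. arrow x \<and> src x = src q \<and> tgt x = tgt q \<and> x \<star> p = q \<star> p"
    by (rule hcomp_right_bijective) (use assms in \<open>simp_all add: hcomp_arrow arrow_endpoints\<close>)
  then show ?thesis using assms by metis
qed

lemma associator_arrow:
  assumes "point h" "point g" "point f" "ysrc h = ytgt g" "ysrc g = ytgt f"
  shows "arrow (associator h g f)" "src (associator h g f) = (h \<odot> g) \<odot> f"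
    "tgt (associator h g f) = h \<odot> g \<odot> f"
proof -
  have "associator h g f \<in> qfibre D ((h \<odot> g) \<odot> f) (h \<odot> g \<odot> f)"
    by (rule ahat_axiom) (use assms in \<open>simp_all add: yfibre_iff\<close>)
  then show "arrow (associator h g f)" "src (associator h g f) = (h \<odot> g) \<odot> f"
    "tgt (associator h g f) = h \<odot> g \<odot> f"
    by (auto simp: gfibre_iff)
qed

lemma associator_natural:
  assumes "arrow r" "arrow q" "arrow p" "ysrc (src r) = ytgt (src q)" "ysrc (src q) = ytgt (src p)"
  shows "associator (tgt r) (tgt q) (tgt p) \<cdot> ((r \<star> q) \<star> p) =
    (r \<star> q \<star> p) \<cdot> associator (src r) (src q) (src p)"
proof -
  let ?x1 = "ysrc (src p)" let ?x2 = "ytgt (src p)" let ?x3 = "ytgt (src q)" let ?x4 = "ytgt (src r)"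
  have y: "src r \<in> yfibre D ?x3 ?x4" "tgt r \<in> yfibre D ?x3 ?x4"
    "src q \<in> yfibre D ?x2 ?x3" "tgt q \<in> yfibre D ?x2 ?x3"
    "src p \<in> yfibre D ?x1 ?x2" "tgt p \<in> yfibre D ?x1 ?x2"
    and f: "r \<in> qfibre D (src r) (tgt r)" "q \<in> qfibre D (src q) (tgt q)"
      "p \<in> qfibre D (src p) (tgt p)"
    using assms by (simp_all add: yfibre_iff gfibre_iff arrow_endpoints arrow_cover_proj)
  show ?thesis by (rule naturality_axiom[OF y f])
qed

lemma pentagon:
  assumes "point k" "point h" "point g" "point f" "ysrc k = ytgt h" "ysrc h = ytgt g" "ysrc g = ytgt f"
  shows "associator k h (g \<odot> f) \<cdot> associator (k \<odot> h) g f =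
    (ident k \<star> associator h g f) \<cdot> associator k (h \<odot> g) f \<cdot> (associator k h g \<star> ident f)"
    (is "?B \<cdot> ?A = ?R")
proof -
  note [simp] = assms vcomp_arrow hcomp_arrow hcomp_point associator_arrow ident_arrow inver_props
    ident_neutral
  have coh: "inver ?A \<cdot> inver ?B \<cdot> ?R = ident (((k \<odot> h) \<odot> g) \<odot> f)"
    by (rule pentagon_axiom) (use assms in \<open>simp_all add: yfibre_iff\<close>)
  have "inver ?B \<cdot> ?R = ?A \<cdot> ident (((k \<odot> h) \<odot> g) \<odot> f)"
    by (rule move_inver[OF coh]) simp_all
  then have "inver ?B \<cdot> ?R = ?A" by simp
  then show ?thesis by (rule move_inver[symmetric]) simp_all
qed

lemma whisker_left:
  assumes "point g" "arrow p" "arrow q" "src p = tgt q" "ysrc g = ytgt (src q)"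
  shows "ident g \<star> (p \<cdot> q) = (ident g \<star> p) \<cdot> (ident g \<star> q)"
  using interchange[of "ident g" "ident g" q p] assms by (simp add: ident_arrow ident_neutral)

lemma whisker_right:
  assumes "point f" "arrow p" "arrow q" "src p = tgt q" "ysrc (src q) = ytgt f"
  shows "(p \<cdot> q) \<star> ident f = (p \<star> ident f) \<cdot> (q \<star> ident f)"
  using interchange[of q p "ident f" "ident f"] assms by (simp add: ident_arrow ident_neutral)

lemma hcomp_slide:
  assumes "arrow q" "arrow p" "ysrc (src q) = ytgt (src p)"
  shows "(q \<star> ident (tgt p)) \<cdot> (ident (src q) \<star> p) = q \<star> p"
    and "(ident (tgt q) \<star> p) \<cdot> (q \<star> ident (src p)) = q \<star> p"
  using assms
  by (simp_all add: arrow_endpoints arrow_cover_proj ident_arrow ident_neutral flip: interchange)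

lemma cover_proj_image:
  "cover_proj (gerbe D) ` pts (cover (gerbe D)) = pts (fibre_square (space D) (proj D))"
  using bundle_2_gerbe unfolding bundle_2_gerbe_def bundle_gerbe_def locally_split_def by metis

lemma base_point:
  assumes "point y"
  shows "ysrc y \<in> pts (space D)" "ytgt y \<in> pts (space D)"
proof -
  have "cover_proj (gerbe D) y \<in> pts (fibre_square (space D) (proj D))"
    using assms unfolding cover_proj_image[symmetric] point_def by (rule imageI)
  then show "ysrc y \<in> pts (space D)" "ytgt y \<in> pts (space D)"
    by (auto simp: fibre_square_def subspace_of_def prod_space_def)
qed

lemma diagonal_section_exists: "\<exists>\<iota>. diagonal_section D \<iota>"
proof -
  have "\<exists>y. y \<in> yfibre D x x" if "x \<in> pts (space D)" for x
  proof -
    have "(x, x) \<in> cover_proj (gerbe D) ` pts (cover (gerbe D))"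
      using that by (simp add: cover_proj_image fibre_square_def subspace_of_def prod_space_def)
    then show ?thesis by (auto simp: yfibre_def)
  qed
  then show ?thesis unfolding diagonal_section_def by metis
qed

end


section \<open>Unit constraints\<close>

locale unital_two_gerbe_fibres = two_gerbe_fibres D
  for D :: "('q, 'eq::banach, 'y, 'ey::banach, 'x, 'ex::banach, 'm, 'em::banach) bundle_2_gerbe_data" +
  fixes \<iota> :: "'x \<Rightarrow> 'y"
  assumes diagonal_section: "diagonal_section D \<iota>"
begin

lemma unit_point:
  assumes "x \<in> pts (space D)"
  shows "point (\<iota> x)" "cover_proj (gerbe D) (\<iota> x) = (x, x)"
proof -
  have "\<iota> x \<in> yfibre D x x" using diagonal_section assms by (simp add: diagonal_section_def)
  then show "point (\<iota> x)" "cover_proj (gerbe D) (\<iota> x) = (x, x)"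
    by (auto simp: yfibre_iff prod_eq_iff)
qed

text \<open>
  The choice of this 2-arrow is free, but the left and the right unit constraint have to be built
  from the same one: another choice for one of them would multiply it by a scalar and spoil the
  triangle identity.
\<close>

definition contraction :: "'x \<Rightarrow> 'q" where
  "contraction x = (SOME u. arrow u \<and> src u = \<iota> x \<odot> \<iota> x \<and> tgt u = \<iota> x)"

lemma contraction_arrow:
  assumes "x \<in> pts (space D)"
  shows "arrow (contraction x)" "src (contraction x) = \<iota> x \<odot> \<iota> x" "tgt (contraction x) = \<iota> x"
proof -
  have "\<exists>u. arrow u \<and> src u = \<iota> x \<odot> \<iota> x \<and> tgt u = \<iota> x"
    using arrow_exists[of "\<iota> x \<odot> \<iota> x" "\<iota> x"] assms by (auto simp: unit_point hcomp_point)
  from someI_ex[OF this]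
  show "arrow (contraction x)" "src (contraction x) = \<iota> x \<odot> \<iota> x" "tgt (contraction x) = \<iota> x"
    by (auto simp: contraction_def)
qed

definition left_unitor :: "'y \<Rightarrow> 'q" where
  "left_unitor f = (let i = \<iota> (ytgt f) in
     THE p. arrow p \<and> src p = i \<odot> f \<and> tgt p = f \<and>
       ident i \<star> p = (contraction (ytgt f) \<star> ident f) \<cdot> inver (associator i i f))"

definition right_unitor :: "'y \<Rightarrow> 'q" where
  "right_unitor g = (let i = \<iota> (ysrc g) in
     THE p. arrow p \<and> src p = g \<odot> i \<and> tgt p = g \<and>
       p \<star> ident i = (ident g \<star> contraction (ysrc g)) \<cdot> associator g i i)"

lemmas arrow_simps = arrow_endpoints arrow_cover_proj vcomp_arrow hcomp_arrow hcomp_point associator_arrow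
  ident_arrow inver_props ident_neutral hcomp_ident base_point unit_point contraction_arrow

lemma left_unitor_props:
  assumes "point f"
  shows "arrow (left_unitor f)" "src (left_unitor f) = \<iota> (ytgt f) \<odot> f" "tgt (left_unitor f) = f"
    and left_unitor_defining: "(ident (\<iota> (ytgt f)) \<star> left_unitor f) \<cdot>
      associator (\<iota> (ytgt f)) (\<iota> (ytgt f)) f = contraction (ytgt f) \<star> ident f"
proof -
  note [simp] = arrow_simps assms
  define i where "i = \<iota> (ytgt f)"
  have "\<exists>!p. arrow p \<and> src p = i \<odot> f \<and> tgt p = f \<and>
       ident i \<star> p = (contraction (ytgt f) \<star> ident f) \<cdot> inver (associator i i f)"
    by (rule hcomp_left_bijective) (simp_all add: i_def prod_eq_iff)
  from theI'[OF this] have l: "arrow (left_unitor f) \<and> src (left_unitor f) = i \<odot> f \<and> tgt (left_unitor f) = f \<and>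
       ident i \<star> left_unitor f = (contraction (ytgt f) \<star> ident f) \<cdot> inver (associator i i f)"
    unfolding left_unitor_def Let_def i_def .
  then show "arrow (left_unitor f)" "src (left_unitor f) = \<iota> (ytgt f) \<odot> f" "tgt (left_unitor f) = f"
    by (auto simp: i_def)
  show "(ident (\<iota> (ytgt f)) \<star> left_unitor f) \<cdot>
      associator (\<iota> (ytgt f)) (\<iota> (ytgt f)) f = contraction (ytgt f) \<star> ident f"
    using l by (simp add: i_def vcomp_assoc)
qed

lemma right_unitor_props:
  assumes "point g"
  shows "arrow (right_unitor g)" "src (right_unitor g) = g \<odot> \<iota> (ysrc g)" "tgt (right_unitor g) = g"
    and right_unitor_defining: "right_unitor g \<star> ident (\<iota> (ysrc g)) =
      (ident g \<star> contraction (ysrc g)) \<cdot> associator g (\<iota> (ysrc g)) (\<iota> (ysrc g))"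
proof -
  note [simp] = arrow_simps assms
  define i where "i = \<iota> (ysrc g)"
  have "\<exists>!p. arrow p \<and> src p = g \<odot> i \<and> tgt p = g \<and>
       p \<star> ident i = (ident g \<star> contraction (ysrc g)) \<cdot> associator g i i"
    by (rule hcomp_right_bijective) (simp_all add: i_def prod_eq_iff)
  from theI'[OF this] have r: "arrow (right_unitor g) \<and> src (right_unitor g) = g \<odot> i \<and> tgt (right_unitor g) = g \<and>
       right_unitor g \<star> ident i = (ident g \<star> contraction (ysrc g)) \<cdot> associator g i i"
    unfolding right_unitor_def Let_def i_def .
  then show "arrow (right_unitor g)" "src (right_unitor g) = g \<odot> \<iota> (ysrc g)" "tgt (right_unitor g) = g"
    "right_unitor g \<star> ident (\<iota> (ysrc g)) =
      (ident g \<star> contraction (ysrc g)) \<cdot> associator g (\<iota> (ysrc g)) (\<iota> (ysrc g))"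
    by (auto simp: i_def)
qed

text \<open>
  After whiskering with the unit and composing with the associator, both sides become the
  composite \<open>u \<star> p\<close>, read as two whiskerings in either order; the added factors
  then cancel.
\<close>

lemma left_unitor_natural:
  assumes p: "arrow p"
  shows "left_unitor (tgt p) \<cdot> (ident (\<iota> (ytgt (src p))) \<star> p) = p \<cdot> left_unitor (src p)"
proof -
  define f where "f = src p"
  define f' where "f' = tgt p"
  define x where "x = ytgt f"
  define i where "i = \<iota> x"
  define u where "u = contraction x"
  have pf: "src p = f" "tgt p = f'" by (simp_all add: f_def f'_def)
  have f: "point f" "point f'" "ytgt f = x" "ytgt f' = x" "ysrc f' = ysrc f"
    using p by (simp_all add: f_def f'_def x_def arrow_endpoints arrow_cover_proj)
  have i: "point i" "cover_proj (gerbe D) i = (x, x)" and u: "arrow u" "src u = i \<odot> i" "tgt u = i"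
    using base_point[OF f(1)] f(3) by (simp_all add: i_def u_def unit_point contraction_arrow)
  have l: "arrow (left_unitor f)" "src (left_unitor f) = i \<odot> f" "tgt (left_unitor f) = f"
    and l': "arrow (left_unitor f')" "src (left_unitor f') = i \<odot> f'" "tgt (left_unitor f') = f'"
    using left_unitor_props(1-3)[OF f(1)] left_unitor_props(1-3)[OF f(2)] f by (simp_all add: i_def)
  have def: "(ident i \<star> left_unitor f) \<cdot> associator i i f = u \<star> ident f"
    and def': "(ident i \<star> left_unitor f') \<cdot> associator i i f' = u \<star> ident f'"
    using left_unitor_defining[OF f(1)] left_unitor_defining[OF f(2)] f by (simp_all add: i_def u_def)
  note [simp] = p pf f i u l l' arrow_simps
  have nat: "(ident i \<star> ident i \<star> p) \<cdot> associator i i f = associator i i f' \<cdot> (ident (i \<odot> i) \<star> p)"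
    using associator_natural[of "ident i" "ident i" p] by simp
  have "(ident i \<star> (left_unitor f' \<cdot> (ident i \<star> p))) \<cdot> associator i i f =
      (ident i \<star> left_unitor f') \<cdot> (ident i \<star> ident i \<star> p) \<cdot> associator i i f"
    by (simp add: whisker_left vcomp_assoc)
  also have "\<dots> = ((ident i \<star> left_unitor f') \<cdot> associator i i f') \<cdot> (ident (i \<odot> i) \<star> p)"
    by (simp add: nat vcomp_assoc)
  also have "\<dots> = (ident i \<star> p) \<cdot> (u \<star> ident f)"
    using hcomp_slide[of u p] by (simp add: def')
  also have "\<dots> = ((ident i \<star> p) \<cdot> (ident i \<star> left_unitor f)) \<cdot> associator i i f"
    by (simp add: vcomp_assoc flip: def)
  also have "\<dots> = (ident i \<star> (p \<cdot> left_unitor f)) \<cdot> associator i i f"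
    by (simp add: whisker_left)
  finally have "ident i \<star> (left_unitor f' \<cdot> (ident i \<star> p)) = ident i \<star> (p \<cdot> left_unitor f)"
    by (rule vcomp_right_cancel) simp_all
  then have "left_unitor f' \<cdot> (ident i \<star> p) = p \<cdot> left_unitor f"
    by (rule hcomp_left_cancel) simp_all
  then show ?thesis by (simp add: i_def)
qed

text \<open>The mirror image of the previous argument.\<close>

lemma right_unitor_natural:
  assumes q: "arrow q"
  shows "right_unitor (tgt q) \<cdot> (q \<star> ident (\<iota> (ysrc (src q)))) = q \<cdot> right_unitor (src q)"
proof -
  define g where "g = src q"
  define g' where "g' = tgt q"
  define x where "x = ysrc g"
  define i where "i = \<iota> x"
  define u where "u = contraction x"
  have qg: "src q = g" "tgt q = g'" by (simp_all add: g_def g'_def)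
  have g: "point g" "point g'" "ysrc g = x" "ysrc g' = x" "ytgt g' = ytgt g"
    using q by (simp_all add: g_def g'_def x_def arrow_endpoints arrow_cover_proj)
  have i: "point i" "cover_proj (gerbe D) i = (x, x)" and u: "arrow u" "src u = i \<odot> i" "tgt u = i"
    using base_point[OF g(1)] g(3) by (simp_all add: i_def u_def unit_point contraction_arrow)
  have r: "arrow (right_unitor g)" "src (right_unitor g) = g \<odot> i" "tgt (right_unitor g) = g"
    and r': "arrow (right_unitor g')" "src (right_unitor g') = g' \<odot> i" "tgt (right_unitor g') = g'"
    using right_unitor_props(1-3)[OF g(1)] right_unitor_props(1-3)[OF g(2)] g by (simp_all add: i_def)
  have def: "right_unitor g \<star> ident i = (ident g \<star> u) \<cdot> associator g i i"
    and def': "right_unitor g' \<star> ident i = (ident g' \<star> u) \<cdot> associator g' i i"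
    using right_unitor_defining[OF g(1)] right_unitor_defining[OF g(2)] g by (simp_all add: i_def u_def)
  note [simp] = q qg g i u r r' arrow_simps
  have nat: "associator g' i i \<cdot> ((q \<star> ident i) \<star> ident i) = (q \<star> ident (i \<odot> i)) \<cdot> associator g i i"
    using associator_natural[of q "ident i" "ident i"] by simp
  have "(right_unitor g' \<cdot> (q \<star> ident i)) \<star> ident i =
      (ident g' \<star> u) \<cdot> associator g' i i \<cdot> ((q \<star> ident i) \<star> ident i)"
    by (simp add: whisker_right def' vcomp_assoc)
  also have "\<dots> = ((ident g' \<star> u) \<cdot> (q \<star> ident (i \<odot> i))) \<cdot> associator g i i"
    by (simp add: nat vcomp_assoc)
  also have "\<dots> = ((q \<star> ident i) \<cdot> (ident g \<star> u)) \<cdot> associator g i i"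
    using hcomp_slide[of q u] by simp
  also have "\<dots> = (q \<cdot> right_unitor g) \<star> ident i"
    by (simp add: whisker_right def vcomp_assoc)
  finally have "right_unitor g' \<cdot> (q \<star> ident i) = q \<cdot> right_unitor g"
    by (rule hcomp_right_cancel) simp_all
  then show ?thesis by (simp add: i_def)
qed

text \<open>
  Both unit constraints are known only after a further composition with the unit, and the pentagon
  for \<open>g, i, i, f\<close> is where these two composites meet: it gives the triangle for
  \<open>g\<close> and \<open>i f\<close>, in the form
  \<open>a(g, i, f) \<cdot> ((g i) \<star> l) = r \<star> (i f)\<close>. Interchange of \<open>r\<close> and \<open>l\<close> turns it into
  the triangle for \<open>g, f\<close> composed with the invertible 2-arrow
  \<open>(g i) \<star> l\<close>.
\<close>

lemma triangle:
  assumes g: "point g" and f: "point f" and gf: "ysrc g = ytgt f"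
  shows "(ident g \<star> left_unitor f) \<cdot> associator g (\<iota> (ysrc g)) f = right_unitor g \<star> ident f"
proof -
  define x where "x = ytgt f"
  define i where "i = \<iota> x"
  define u where "u = contraction x"
  define l where "l = left_unitor f"
  define r where "r = right_unitor g"
  have x: "ytgt f = x" "ysrc g = x" by (simp_all add: x_def gf)
  have i: "point i" "cover_proj (gerbe D) i = (x, x)" and u: "arrow u" "src u = i \<odot> i" "tgt u = i"
    using base_point[OF f(1)] x by (simp_all add: i_def u_def unit_point contraction_arrow)
  have l: "arrow l" "src l = i \<odot> f" "tgt l = f"
    and r: "arrow r" "src r = g \<odot> i" "tgt r = g"
    using left_unitor_props(1-3)[OF f] right_unitor_props(1-3)[OF g] x
    by (simp_all add: i_def l_def r_def)
  have ldef: "(ident i \<star> l) \<cdot> associator i i f = u \<star> ident f"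
    using left_unitor_defining[OF f] x by (simp add: i_def u_def l_def)
  have rdef: "r \<star> ident i = (ident g \<star> u) \<cdot> associator g i i"
    using right_unitor_defining[OF g] x by (simp add: i_def u_def r_def)
  note [simp] = g f x i u l r arrow_simps
  let ?a = "associator g i f"
  have nat_l: "(ident g \<star> ident i \<star> l) \<cdot> associator g i (i \<odot> f) = ?a \<cdot> (ident (g \<odot> i) \<star> l)"
    using associator_natural[of "ident g" "ident i" l] by simp
  have nat_u: "(ident g \<star> u \<star> ident f) \<cdot> associator g (i \<odot> i) f = ?a \<cdot> ((ident g \<star> u) \<star> ident f)"
    using associator_natural[of "ident g" u "ident f"] by simp
  have nat_r: "?a \<cdot> ((r \<star> ident i) \<star> ident f) = (r \<star> ident (i \<odot> f)) \<cdot> associator (g \<odot> i) i f"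
    using associator_natural[of r "ident i" "ident f"] by simp
  \<comment> \<open>The pentagon, with \<open>l\<close> whiskered on at the end; \<open>u\<close> converts the occurrence of
    \<open>l\<close> into one of \<open>r\<close>.\<close>
  have "(?a \<cdot> (ident (g \<odot> i) \<star> l)) \<cdot> associator (g \<odot> i) i f =
      (ident g \<star> ident i \<star> l) \<cdot> associator g i (i \<odot> f) \<cdot> associator (g \<odot> i) i f"
    by (simp add: vcomp_assoc flip: nat_l)
  also have "\<dots> = (ident g \<star> ident i \<star> l) \<cdot> (ident g \<star> associator i i f) \<cdot>
      associator g (i \<odot> i) f \<cdot> (associator g i i \<star> ident f)"
    by (simp add: pentagon)
  also have "\<dots> = (ident g \<star> ((ident i \<star> l) \<cdot> associator i i f)) \<cdot>
      associator g (i \<odot> i) f \<cdot> (associator g i i \<star> ident f)"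
    by (simp add: whisker_left vcomp_assoc)
  also have "\<dots> = ((ident g \<star> u \<star> ident f) \<cdot> associator g (i \<odot> i) f) \<cdot> (associator g i i \<star> ident f)"
    by (simp add: ldef vcomp_assoc)
  also have "\<dots> = ?a \<cdot> (((ident g \<star> u) \<cdot> associator g i i) \<star> ident f)"
    by (simp add: nat_u whisker_right vcomp_assoc)
  also have "\<dots> = (r \<star> ident (i \<odot> f)) \<cdot> associator (g \<odot> i) i f"
    using nat_r by (simp add: rdef)
  finally have "?a \<cdot> (ident (g \<odot> i) \<star> l) = r \<star> ident (i \<odot> f)"
    by (rule vcomp_right_cancel) simp_all
  then have "((ident g \<star> l) \<cdot> ?a) \<cdot> (ident (g \<odot> i) \<star> l) = (ident g \<star> l) \<cdot> (r \<star> ident (i \<odot> f))"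
    by (simp add: vcomp_assoc)
  also have "\<dots> = (r \<star> ident f) \<cdot> (ident (g \<odot> i) \<star> l)"
    using hcomp_slide[of r l] by simp
  finally have "(ident g \<star> l) \<cdot> ?a = r \<star> ident f"
    by (rule vcomp_right_cancel) simp_all
  then show ?thesis by (simp add: l_def r_def i_def)
qed


section \<open>The bicategory over a point\<close>

lemmas fibre_simps = fibre_hom_def prod_cat_def yfibre_iff gfibre_iff

lemma category_fibre_hom: "category (fibre_hom D x y)"
  unfolding category_def fibre_hom_def
  by (auto simp: yfibre_iff gfibre_iff ident_arrow ident_neutral vcomp_arrow vcomp_assoc)

lemma composition_functor:
  "is_functor (prod_cat (fibre_hom D y z) (fibre_hom D x y)) (fibre_hom D x z)
     (\<lambda>(g, f). g \<odot> f) (\<lambda>(\<beta>, \<alpha>). \<beta> \<star> \<alpha>)"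
  unfolding is_functor_def
  by (auto simp: fibre_simps hcomp_point hcomp_arrow hcomp_ident interchange)

text \<open>Invertibility of the components is automatic in a groupoid.\<close>

lemma is_nat_isoI:
  assumes "\<And>a. a \<in> Ob C \<Longrightarrow> \<theta> a \<in> qfibre D (F0 a) (G0 a)"
    and "\<And>a b f. a \<in> Ob C \<Longrightarrow> b \<in> Ob C \<Longrightarrow> f \<in> Arr C a b \<Longrightarrow> \<theta> b \<cdot> F1 f = G1 f \<cdot> \<theta> a"
  shows "is_nat_iso C (fibre_hom D x y) F0 F1 G0 G1 \<theta>"
  unfolding is_nat_iso_def
proof (intro conjI ballI)
  fix a assume a: "a \<in> Ob C"
  from assms(1)[OF a] have \<theta>: "arrow (\<theta> a)" "src (\<theta> a) = F0 a" "tgt (\<theta> a) = G0 a"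
    by (simp_all add: gfibre_iff)
  then show "\<theta> a \<in> Arr (fibre_hom D x y) (F0 a) (G0 a)"
    by (simp add: fibre_simps)
  show "\<exists>\<theta>'\<in>Arr (fibre_hom D x y) (G0 a) (F0 a).
      Comp (fibre_hom D x y) \<theta>' (\<theta> a) = Idt (fibre_hom D x y) (F0 a) \<and>
      Comp (fibre_hom D x y) (\<theta> a) \<theta>' = Idt (fibre_hom D x y) (G0 a)"
    by (rule bexI[of _ "inver (\<theta> a)"]) (simp_all add: fibre_simps \<theta> inver_props)
qed (simp add: fibre_hom_def assms(2))

lemma associator_nat_iso:
  "is_nat_iso (prod_cat (fibre_hom D y z) (prod_cat (fibre_hom D x y) (fibre_hom D w x)))
     (fibre_hom D w z)
     (\<lambda>(h, g, f). (h \<odot> g) \<odot> f) (\<lambda>(\<gamma>, \<beta>, \<alpha>). (\<gamma> \<star> \<beta>) \<star> \<alpha>)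
     (\<lambda>(h, g, f). h \<odot> g \<odot> f) (\<lambda>(\<gamma>, \<beta>, \<alpha>). \<gamma> \<star> \<beta> \<star> \<alpha>)
     (\<lambda>(h, g, f). associator h g f)"
proof (rule is_nat_isoI, goal_cases)
  case 1
  then show ?case by (auto simp: fibre_simps associator_arrow)
next
  case 2
  then show ?case by (auto simp: fibre_simps intro!: associator_natural)
qed

lemma left_unitor_nat_iso:
  "is_nat_iso (fibre_hom D x y) (fibre_hom D x y) (\<lambda>f. \<iota> y \<odot> f) (\<lambda>\<alpha>. ident (\<iota> y) \<star> \<alpha>)
     (\<lambda>f. f) (\<lambda>\<alpha>. \<alpha>) left_unitor"
proof (rule is_nat_isoI, goal_cases)
  case 1
  then show ?case by (auto simp: fibre_simps left_unitor_props)
next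
  case 2
  then show ?case using left_unitor_natural by (auto simp: fibre_simps)
qed

lemma right_unitor_nat_iso:
  "is_nat_iso (fibre_hom D x y) (fibre_hom D x y) (\<lambda>f. f \<odot> \<iota> x) (\<lambda>\<alpha>. \<alpha> \<star> ident (\<iota> x))
     (\<lambda>f. f) (\<lambda>\<alpha>. \<alpha>) right_unitor"
proof (rule is_nat_isoI, goal_cases)
  case 1
  then show ?case by (auto simp: fibre_simps right_unitor_props)
next
  case 2
  then show ?case using right_unitor_natural by (auto simp: fibre_simps)
qed

lemma bicategory_fibre_bicat:
  "bicategory (fibre_bicat D m \<iota> (\<lambda>_ _. left_unitor) (\<lambda>_ _. right_unitor))"
proof -
  have sel: "Ob (fibre_hom D x y) = yfibre D x y" "Idt (fibre_hom D x y) = ident"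
    "Comp (fibre_hom D x y) = gmult (gerbe D)" for x y
    by (simp_all add: fibre_hom_def)
  show ?thesis
    unfolding bicategory_def Let_def fibre_bicat_def bicat_data.simps sel
    by (intro conjI ballI category_fibre_hom composition_functor associator_nat_iso
        left_unitor_nat_iso right_unitor_nat_iso)
      (auto simp: unit_point yfibre_iff pentagon triangle)
qed

end

theorem proposition8p1:
  fixes D :: "('q, 'eq::banach, 'y, 'ey::banach, 'x, 'ex::banach, 'm, 'em::banach) bundle_2_gerbe_data"
  assumes "bundle_2_gerbe D"
  shows "(\<exists>\<iota>. diagonal_section D \<iota>) \<and>
    (\<forall>\<iota>. diagonal_section D \<iota> \<longrightarrow>
      (\<forall>m \<in> pts (base D). \<exists>l r. bicategory (fibre_bicat D m \<iota> l r)))"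
proof -
  interpret two_gerbe_fibres D by unfold_locales (rule assms)
  have "\<exists>l r. bicategory (fibre_bicat D m \<iota> l r)" if "diagonal_section D \<iota>" for m \<iota>
  proof -
    interpret unital_two_gerbe_fibres D \<iota> by unfold_locales (rule that)
    show ?thesis using bicategory_fibre_bicat by blast
  qed
  then show ?thesis using diagonal_section_exists by blast
qed

end
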